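(* Let $\lambda>-1/2$ and $m\geq 1$. Define monic polynomials $P_k$ by $P_0(\mu)=1$, $P_1(\mu)=\mu-\frac{1}{\alpha_1^2\beta_1^2}$ and, for $k\geq 2$, $$P_k(\mu)=\Big[\mu-\frac{1}{\alpha_k^2}\Big(\frac{1}{\beta_{k-1}^2}+\frac{1}{\beta_k^2}\Big)\Big]P_{k-1}(\mu)-\frac{1}{\alpha_{k-1}^2\alpha_k^2\beta_{k-1}^4}P_{k-2}(\mu),$$ and define $\widetilde P_k$ by the same recurrence with $\alpha,\beta$ replaced by $\widetilde\alpha,\widetilde\beta$. Then $\{P_k\}$ and $\{\widetilde P_k\}$ are orthogonal with respect to measures supported on $\mathbb{R}_+$, and the best Markov constant satisfies $$c_n(\lambda)=\frac{2}{\sqrt{\mu_1}}\ \text{ if } n=2m,\qquad c_n(\lambda)=\frac{2}{\sqrt{\widetilde\mu_1}}\ \text{ if } n=2m-1,$$ where $\mu_1$ and $\widetilde\mu_1$ are the smallest zeros of $P_m$ and $\widetilde P_m$, respectively.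
   Context: $\mathcal{P}_n$ denotes the class of real algebraic polynomials of degree at most $n$; $w_\lambda(t)=(1-t^2)^{\lambda-1/2}$ on $(-1,1)$, $\Vert f\Vert_{w_\lambda}=\big(\int_{-1}^1 w_\lambda f^2\,dt\big)^{1/2}$, and $c_n(\lambda)=\sup\{\Vert p'\Vert_{w_\lambda}/\Vert p\Vert_{w_\lambda}: p\in\mathcal{P}_n,\ p\neq 0\}$. For integers $i\geq 0$ let $h_i>0$ with $h_i^2=\frac{\Gamma(i+2\lambda)}{(i+\lambda)\Gamma(i+1)}$. For $k\geq1$: $\alpha_k=(2k-1+\lambda)h_{2k-1}$, $\beta_k=1/h_{2k}$, $\widetilde\alpha_k=(2k-2+\lambda)h_{2k-2}$, $\widetilde\beta_k=1/h_{2k-1}$ (with $\widetilde\alpha_1^2=\lambda\Gamma(2\lambda)=\Gamma(2\lambda+1)/2$, understood by continuity at $\lambda=0$). *)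

theory Defs
  imports "HOL-Analysis.Analysis" "HOL-Computational_Algebra.Polynomial"
begin

definition w_lambda :: "real \<Rightarrow> real \<Rightarrow> real" where
  "w_lambda lam t = (1 - t\<^sup>2) powr (lam - 1/2)"

definition wnorm :: "real \<Rightarrow> (real \<Rightarrow> real) \<Rightarrow> real" where
  "wnorm lam f = sqrt (LBINT t:{-1<..<1}. w_lambda lam t * (f t)\<^sup>2)"

definition markov_const :: "nat \<Rightarrow> real \<Rightarrow> real" where
  "markov_const n lam =
     Sup {wnorm lam (poly (pderiv p)) / wnorm lam (poly p) | p :: real poly. degree p \<le> n \<and> p \<noteq> 0}"

definition hsq :: "real \<Rightarrow> nat \<Rightarrow> real" where
  "hsq lam i = Gamma (real i + 2*lam) / ((real i + lam) * Gamma (real i + 1))"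

text \<open>Squares of alpha_k, beta_k, tilde alpha_k, tilde beta_k (only squares enter the recurrence).\<close>
definition alpha_sq :: "real \<Rightarrow> nat \<Rightarrow> real" where
  "alpha_sq lam k = (2 * real k - 1 + lam)\<^sup>2 * hsq lam (2*k - 1)"

definition beta_sq :: "real \<Rightarrow> nat \<Rightarrow> real" where
  "beta_sq lam k = 1 / hsq lam (2*k)"

definition alpha_tilde_sq :: "real \<Rightarrow> nat \<Rightarrow> real" where
  "alpha_tilde_sq lam k =
     (if k = 1 then Gamma (2*lam + 1) / 2
      else (2 * real k - 2 + lam)\<^sup>2 * hsq lam (2*k - 2))"

definition beta_tilde_sq :: "real \<Rightarrow> nat \<Rightarrow> real" where
  "beta_tilde_sq lam k = 1 / hsq lam (2*k - 1)"

text \<open>Monic polynomials given by the three-term recurrence; a k = alpha_k^2, b k = beta_k^2.\<close>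
fun Prec :: "(nat \<Rightarrow> real) \<Rightarrow> (nat \<Rightarrow> real) \<Rightarrow> nat \<Rightarrow> real poly" where
  "Prec a b 0 = 1"
| "Prec a b (Suc 0) = [: - 1 / (a 1 * b 1), 1 :]"
| "Prec a b (Suc (Suc k)) =
     [: - (1 / a (k+2)) * (1 / b (k+1) + 1 / b (k+2)), 1 :] * Prec a b (Suc k)
     - smult (1 / (a (k+1) * a (k+2) * (b (k+1))\<^sup>2)) (Prec a b k)"

definition P_seq :: "real \<Rightarrow> nat \<Rightarrow> real poly" where
  "P_seq lam = Prec (alpha_sq lam) (beta_sq lam)"

definition P_tilde_seq :: "real \<Rightarrow> nat \<Rightarrow> real poly" where
  "P_tilde_seq lam = Prec (alpha_tilde_sq lam) (beta_tilde_sq lam)"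

definition orthogonal_on_Rplus :: "(nat \<Rightarrow> real poly) \<Rightarrow> bool" where
  "orthogonal_on_Rplus P \<longleftrightarrow>
     (\<exists>M :: real measure. sets M = sets borel \<and> emeasure M {..<0} = 0 \<and>
        (\<forall>j k. integrable M (\<lambda>x. poly (P j) x * poly (P k) x)) \<and>
        (\<forall>j k. j \<noteq> k \<longrightarrow> integral\<^sup>L M (\<lambda>x. poly (P j) x * poly (P k) x) = 0) \<and>
        (\<forall>k. integral\<^sup>L M (\<lambda>x. (poly (P k) x)\<^sup>2) > 0))"

definition smallest_zero :: "real poly \<Rightarrow> real" where
  "smallest_zero p = Min {x. poly p x = 0}"

end

theory Submission
  imports Defs "HOL-Probability.Probability" "HOL-Computational_Algebra.Fundamental_Theorem_Algebra"
begin

text \<open>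
  Expand a polynomial in the Gegenbauer basis and let \<open>S\<^sub>j\<close> be the sum of its coefficients of index
  \<open>j + 1, j + 3, \<dots>\<close>. Since \<open>C\<^sub>k' - C\<^sub>k\<^sub>-\<^sub>2' = 2 (k - 1 + \<lambda>) C\<^sub>k\<^sub>-\<^sub>1\<close>, the squared norms of \<open>p'\<close> and \<open>p\<close>
  become \<open>4 \<Sum> A\<^sub>j S\<^sub>j\<^sup>2\<close> and \<open>\<Sum> h\<^sub>k\<^sup>2 (S\<^sub>k\<^sub>-\<^sub>1 - S\<^sub>k\<^sub>+\<^sub>1)\<^sup>2\<close> with \<open>A\<^sub>j = (j + \<lambda>)\<^sup>2 h\<^sub>j\<^sup>2\<close>. This pencil splits by
  parity into two Jacobi matrices whose characteristic polynomials are \<open>P\<^sub>m\<close> and its tilde variant,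
  so each parity contributes the smallest zero of its polynomial as a minimal Rayleigh quotient.

  That the parity of \<open>n\<close> wins is proved by transplanting a minimiser of one problem into the other,
  after making \<open>S\<close> nonnegative and decreasing. For \<open>\<lambda> \<le> 1\<close> the \<open>h\<^sub>k\<close> decrease, and \<open>A\<^sub>i = D\<^sub>i + D\<^sub>i\<^sub>-\<^sub>1\<close>
  with \<open>D\<^sub>i > 0\<close> makes the partial sums of the \<open>A\<close> interlace, so summation by parts applies; for
  \<open>\<lambda> > 1\<close> the matrix entries themselves can be compared.

  The orthogonality measures are weak limits of the Gaussian quadrature measures at the zeros, which
  stay in a fixed interval \<open>[0, B]\<close>.
\<close>

section \<open>Jacobi matrices\<close>

locale jacobi_recurrence =
  fixes a b :: "nat \<Rightarrow> real"
  assumes a_pos: "k \<ge> 1 \<Longrightarrow> a k > 0" and b_pos: "k \<ge> 1 \<Longrightarrow> b k > 0"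
begin

text \<open>\<open>E k\<close> is the multiple of \<open>Prec a b k\<close> normalised to \<open>1\<close> at the origin. The vector of the values
  \<open>E k x\<close> then solves the eigenvalue equation of the form \<open>\<Sum> (s\<^sub>k - s\<^sub>k\<^sub>+\<^sub>1)\<^sup>2 / b\<^sub>k\<close> relative to \<open>\<Sum> a\<^sub>k s\<^sub>k\<^sup>2\<close>.
  It is polymorphic so that the zeros can be studied over the complex numbers.\<close>

fun E :: "nat \<Rightarrow> 'x::real_field poly" where
  "E 0 = 1"
| "E (Suc 0) = [:1, - of_real (a 1 * b 1):]"
| "E (Suc (Suc k)) =
     [:1 + of_real (b (k+2) / b (k+1)), - of_real (a (k+2) * b (k+2)):] * E (Suc k)
     - smult (of_real (b (k+2) / b (k+1))) (E k)"

text \<open>The leading coefficient of \<open>E k\<close>. As \<open>E k\<close> has value 1 at the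
  origin, it is also the reciprocal of \<open>poly (Prec a b k) 0\<close>.\<close>

definition scl :: "nat \<Rightarrow> real" where
  "scl k = (\<Prod>i<k. - (a (Suc i) * b (Suc i)))"

lemma a_Suc_pos [simp]: "a (Suc k) > 0" and b_Suc_pos [simp]: "b (Suc k) > 0"
  by (auto intro: a_pos b_pos)

lemma a_Suc_nz [simp]: "a (Suc k) \<noteq> 0" and b_Suc_nz [simp]: "b (Suc k) \<noteq> 0"
  using a_Suc_pos[of k] b_Suc_pos[of k] by (metis less_irrefl)+

lemma scl_nz: "scl k \<noteq> 0"
  by (simp add: scl_def)

lemma poly_E_conv_Prec: "poly (E k) x = scl k * poly (Prec a b k) x"
proof (induction k rule: induct_nat_012)
  case (ge2 k)
  have s1: "scl (Suc k) = - (a (Suc k) * b (Suc k)) * scl k"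
    and s2: "scl (Suc (Suc k)) = - (a (Suc (Suc k)) * b (Suc (Suc k))) * scl (Suc k)"
    by (simp_all add: scl_def)
  show ?case
    by (simp add: ge2 s2) (simp add: s1 field_simps power2_eq_square)
qed (simp_all add: scl_def field_simps)

lemma roots_E_conv_Prec: "{x. poly (E k) x = 0} = {x. poly (Prec a b k) x = 0}"
  by (simp add: poly_E_conv_Prec scl_nz)

lemma degree_E: "degree (E k :: 'x::real_field poly) = k"
proof (induction k rule: induct_nat_012)
  case (ge2 k)
  let ?p = "[:1 + of_real (b (k+2) / b (k+1)), - of_real (a (k+2) * b (k+2)):] * (E (Suc k) :: 'x poly)"
  have "E (Suc k) \<noteq> (0 :: 'x poly)"
    using ge2(2) by force
  moreover have "a (k+2) \<noteq> 0" "b (k+2) \<noteq> 0"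
    by simp_all
  ultimately have "degree ?p = k + 2"
    by (subst degree_mult_eq) (auto simp: ge2)
  moreover have "degree (smult (of_real (b (k+2) / b (k+1))) (E k :: 'x poly)) \<le> k"
    using degree_smult_le ge2(1) by metis
  ultimately have "degree (?p + - smult (of_real (b (k+2) / b (k+1))) (E k)) = k + 2"
    by (subst degree_add_eq_left) auto
  then show ?case
    by simp
qed (simp_all del: of_real_mult)

lemma poly_E_of_real:
  "poly (E k) (of_real x :: 'x::real_field) = of_real (poly (E k) x)"
  by (induction k rule: induct_nat_012) simp_all

lemma poly_E_cnj: "poly (E k) (cnj z) = cnj (poly (E k) z)"
  by (induction k rule: induct_nat_012) simp_all

section \<open>Eigenvalue equation in divergence form and the Christoffel-Darboux formula\<close>

definition flux :: "nat \<Rightarrow> 'x::real_field \<Rightarrow> 'x" where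
  "flux k x = (poly (E k) x - poly (E (Suc k)) x) / of_real (b (Suc k))"

text \<open>Together with \<open>eigen_Suc\<close> this restates the three-term recurrence: flux out
  minus flux in equals \<open>x\<close> times the weighted value, and nothing flows in at the left
  end.\<close>

lemma eigen_0: "flux 0 x = x * of_real (a (Suc 0))"
  by (simp add: flux_def)

lemma eigen_Suc: "flux (Suc k) x = flux k x + x * of_real (a (Suc (Suc k))) * poly (E (Suc k)) x"
  by (simp add: flux_def field_simps)

text \<open>A discrete Green identity: in the antisymmetric expression in values and fluxes, the
  flux increments contribute exactly the kernel terms with factor \<open>x - y\<close>.\<close>

lemma christoffel_darboux:
  "(x - y) * (\<Sum>k\<le>n. of_real (a (Suc k)) * poly (E k) x * poly (E k) y) =
     (poly (E n) x * poly (E (Suc n)) y - poly (E n) y * poly (E (Suc n)) x) / of_real (b (Suc n))"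
proof -
  have "(x - y) * (\<Sum>k\<le>n. of_real (a (Suc k)) * poly (E k) x * poly (E k) y) =
      poly (E n) y * flux n x - poly (E n) x * flux n y"
  proof (induction n)
    case 0
    then show ?case by (simp add: eigen_0 algebra_simps)
  next
    case (Suc n)
    have 1: "poly (E (Suc n)) z = poly (E n) z - of_real (b (Suc n)) * flux n z" for z :: 'a
      by (simp add: flux_def)
    \<comment> \<open>The products of the two fluxes cancel, so the values may be shifted from
      \<open>n\<close> to \<open>Suc n\<close> before the fluxes are.\<close>
    have "poly (E (Suc n)) y * flux n x - poly (E (Suc n)) x * flux n y
        = poly (E n) y * flux n x - poly (E n) x * flux n y"
      unfolding 1 by (simp add: algebra_simps)
    then show ?case
      by (simp add: Suc distrib_left eigen_Suc del: E.simps) (simp add: algebra_simps del: E.simps)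
  qed
  also have "\<dots> = (poly (E n) x * poly (E (Suc n)) y - poly (E n) y * poly (E (Suc n)) x) / of_real (b (Suc n))"
    by (simp add: flux_def field_simps del: E.simps)
  finally show ?thesis .
qed

text \<open>The kernel on the diagonal, i.e. the weighted squared length of the vector
  \<open>(E k x)\<close>. At a zero of \<open>E n\<close> its reciprocal is the Gaussian quadrature
  weight, up to normalisation.\<close>

definition mass :: "nat \<Rightarrow> real \<Rightarrow> real" where
  "mass n x = (\<Sum>k<n. a (Suc k) * (poly (E k) x)\<^sup>2)"

section \<open>Reality, simplicity and number of the zeros\<close>

lemma mass_pos: "n > 0 \<Longrightarrow> mass n x > 0"
proof -
  assume "n > 0"
  have "0 < a (Suc 0) * (poly (E 0) x)\<^sup>2" by simp
  also have "\<dots> \<le> mass n x"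
    unfolding mass_def using \<open>n > 0\<close>
    by (intro member_le_sum mult_nonneg_nonneg less_imp_le[OF a_Suc_pos]) auto
  finally show ?thesis .
qed

text \<open>At a zero \<open>z\<close> and its conjugate the boundary term of Christoffel-Darboux
  vanishes, while the kernel is a sum of weighted squared moduli, positive because
  \<open>E 0 = 1\<close>. Hence \<open>z\<close> equals its conjugate.\<close>

lemma E_complex_root_real:
  assumes "poly (E n) (z::complex) = 0"
  shows "z \<in> \<real>"
proof (cases n)
  case 0
  then show ?thesis using assms by simp
next
  case (Suc m)
  have 1: "poly (E n) (cnj z) = 0"
    using assms by (simp add: poly_E_cnj)
  have "(z - cnj z) * (\<Sum>k\<le>m. of_real (a (Suc k)) * poly (E k) z * poly (E k) (cnj z)) = 0"
    using christoffel_darboux[of z "cnj z" m] assms 1 Suc by simp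
  moreover have "(\<Sum>k\<le>m. of_real (a (Suc k)) * poly (E k) z * poly (E k) (cnj z)) =
      of_real (\<Sum>k\<le>m. a (Suc k) * (norm (poly (E k) z))\<^sup>2)"
    by (simp add: poly_E_cnj mult.assoc complex_norm_square[symmetric] del: E.simps of_real_power)
  moreover have "(\<Sum>k\<le>m. a (Suc k) * (norm (poly (E k) z))\<^sup>2) > 0"
  proof -
    have "0 < a (Suc 0) * (norm (poly (E 0) z))\<^sup>2" by simp
    also have "\<dots> \<le> (\<Sum>k\<le>m. a (Suc k) * (norm (poly (E k) z))\<^sup>2)"
      by (intro member_le_sum mult_nonneg_nonneg less_imp_le[OF a_Suc_pos]) auto
    finally show ?thesis .
  qed
  ultimately have "z - cnj z = 0"
    by (simp del: of_real_sum E.simps)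
  then show ?thesis
    by (simp add: Reals_cnj_iff)
qed

text \<open>Differentiating the Christoffel--Darboux formula in the second variable on the diagonal.\<close>

lemma rsquarefree_E: "rsquarefree (E n :: complex poly)"
  unfolding rsquarefree_roots
proof (intro allI notI)
  fix z :: complex
  assume z: "poly (E n) z = 0 \<and> poly (pderiv (E n)) z = 0"
  then obtain m where m: "n = Suc m" by (cases n) auto
  obtain x :: real where x: "z = of_real x"
    using E_complex_root_real z by (metis Reals_cases)
  define K where "K = (\<Sum>k\<le>m. smult (of_real (a (Suc k)) * poly (E k) z) (E k))"
  have K: "poly K y = (\<Sum>k\<le>m. of_real (a (Suc k)) * poly (E k) z * poly (E k) y)" for y
    by (simp add: K_def poly_sum del: E.simps)
  have "[:z, -1:] * K = smult (1 / of_real (b (Suc m)))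
      (smult (poly (E m) z) (E (Suc m)) - smult (poly (E (Suc m)) z) (E m))"
  proof (rule poly_ext)
    fix y
    have "poly ([:z, -1:] * K) y = (z - y) * poly K y"
      by (simp add: algebra_simps)
    then show "poly ([:z, -1:] * K) y = poly (smult (1 / of_real (b (Suc m)))
        (smult (poly (E m) z) (E (Suc m)) - smult (poly (E (Suc m)) z) (E m))) y"
      unfolding K christoffel_darboux by (simp add: mult.commute del: E.simps)
  qed
  then have "poly (pderiv ([:z, -1:] * K)) z = poly (pderiv (smult (1 / of_real (b (Suc m)))
      (smult (poly (E m) z) (E (Suc m)) - smult (poly (E (Suc m)) z) (E m)))) z"
    by simp
  then have "poly K z = 0"
    using z by (simp add: pderiv_add pderiv_minus pderiv_smult pderiv_diff pderiv_pCons m del: E.simps)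
  moreover have "poly K z = of_real (mass n x)"
    unfolding K mass_def m x
    by (simp add: lessThan_Suc_atMost poly_E_of_real power2_eq_square mult.assoc del: E.simps)
  ultimately show False
    using mass_pos[of n x] m by simp
qed

definition roots :: "nat \<Rightarrow> real set" where
  "roots n = {x. poly (E n) x = 0}"

lemma E_nz: "(E n :: 'x::real_field poly) \<noteq> 0"
proof (cases n)
  case (Suc m)
  then show ?thesis
    using degree_E[of n, where 'x = 'x] by force
qed simp

lemma finite_roots [simp]: "finite (roots n)"
  unfolding roots_def by (rule poly_roots_finite) (rule E_nz)

text \<open>Simplicity gives as many complex zeros as the degree, and all of them are real.\<close>

lemma card_roots: "card (roots n) = n"
proof -
  let ?Z = "{z::complex. poly (E n) z = 0}"
  have fin: "finite ?Z"
    by (rule poly_roots_finite) (rule E_nz)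
  have "degree (E n :: complex poly) = degree (smult (lead_coeff (E n)) (\<Prod>z\<in>?Z. [:-z, 1:]))"
    using complex_poly_decompose_rsquarefree[OF rsquarefree_E, of n] by simp
  also have "\<dots> = degree (\<Prod>z\<in>?Z. [:-z, 1:])"
    using E_nz[of n, where 'x = complex] by simp
  also have "\<dots> = card ?Z"
    by (subst degree_prod_eq_sum_degree) auto
  finally have "card ?Z = n"
    by (simp add: degree_E)
  moreover have "?Z = of_real ` roots n"
  proof (intro equalityI subsetI)
    fix z assume z: "z \<in> ?Z"
    then obtain x where "z = of_real x"
      using E_complex_root_real by (metis Reals_cases mem_Collect_eq)
    then show "z \<in> of_real ` roots n"
      using z by (auto simp: roots_def poly_E_of_real)
  qed (auto simp: roots_def poly_E_of_real)
  moreover have "card (complex_of_real ` roots n) = card (roots n)"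
    by (rule card_image) (auto simp: inj_on_def)
  ultimately show ?thesis by simp
qed

section \<open>Discrete orthogonality and Gaussian quadrature\<close>

lemma roots_orthogonal:
  assumes "x \<in> roots n" "y \<in> roots n" "x \<noteq> y"
  shows "(\<Sum>k<n. a (Suc k) * poly (E k) x * poly (E k) y) = 0"
proof (cases n)
  case (Suc m)
  then show ?thesis
    using christoffel_darboux[of x y m] assms
    by (simp add: roots_def lessThan_Suc_atMost del: E.simps)
qed simp

lemma roots_gram:
  assumes "x \<in> roots n" "y \<in> roots n"
  shows "(\<Sum>k<n. a (Suc k) * poly (E k) x * poly (E k) y) = (if x = y then mass n x else 0)"
  using roots_orthogonal[OF assms] by (simp add: mass_def power2_eq_square mult.assoc)

text \<open>The vectors \<open>(E k x)\<close> for the \<open>n\<close> roots \<open>x\<close> are orthogonal in dimension \<open>n\<close>. By Bessel's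
  inequality the projection defect of each unit vector is nonnegative, and the sum of the defects
  is the dimension minus the number of roots, so every defect vanishes.\<close>

lemma quadrature:
  assumes "i < n" "j < n"
  shows "(\<Sum>x\<in>roots n. poly (E i) x * poly (E j) x / mass n x) = (if i = j then 1 / a (Suc j) else 0)"
proof -
  define T where "T i j = (\<Sum>x\<in>roots n. poly (E i) x * poly (E j) x / mass n x)" for i j
  \<comment> \<open>\<open>T\<close> is the reproducing kernel of the span of the root vectors, so
    \<open>t i\<close> is the part of the \<open>i\<close>-th unit vector orthogonal to that
    span.\<close>
  define t where "t i k = (if i = k then 1 else 0) - a (Suc i) * T i k" for i k
  have n: "n > 0" using assms by simp
  have nz: "mass n x \<noteq> 0" for x
    using mass_pos[OF n, of x] by simp
  have TT: "(\<Sum>k<n. a (Suc k) * (T i k)\<^sup>2) = T i i" for i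
  proof -
    have "(\<Sum>k<n. a (Suc k) * (T i k)\<^sup>2) =
      (\<Sum>k<n. \<Sum>x\<in>roots n. \<Sum>y\<in>roots n. (poly (E i) x / mass n x) * (poly (E i) y / mass n y)
          * (a (Suc k) * poly (E k) x * poly (E k) y))"
      unfolding T_def power2_eq_square sum_product
      unfolding sum_distrib_left
      by (intro sum.cong refl) simp
    also have "\<dots> = (\<Sum>x\<in>roots n. \<Sum>y\<in>roots n. (poly (E i) x / mass n x) * (poly (E i) y / mass n y)
          * (\<Sum>k<n. a (Suc k) * poly (E k) x * poly (E k) y))"
      unfolding sum_distrib_left
      by (subst sum.swap, intro sum.cong refl, subst sum.swap, simp)
    also have "\<dots> = (\<Sum>x\<in>roots n. \<Sum>y\<in>roots n. if x = y then poly (E i) x * poly (E i) x / mass n x else 0)"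
      by (intro sum.cong refl) (simp add: roots_gram nz)
    also have "\<dots> = T i i"
      by (simp add: T_def)
    finally show ?thesis .
  qed
  have defect: "(\<Sum>k<n. a (Suc k) * (t i k)\<^sup>2) = a (Suc i) * (1 - a (Suc i) * T i i)" if "i < n" for i
  proof -
    have "(\<Sum>k<n. a (Suc k) * (t i k)\<^sup>2) =
        (\<Sum>k<n. (if i = k then a (Suc k) - 2 * a (Suc k) * a (Suc i) * T i k else 0)
          + (a (Suc i))\<^sup>2 * (a (Suc k) * (T i k)\<^sup>2))"
      by (intro sum.cong refl) (simp add: t_def power2_eq_square algebra_simps)
    also have "\<dots> = a (Suc i) - 2 * a (Suc i) * a (Suc i) * T i i + (a (Suc i))\<^sup>2 * T i i"
      unfolding sum.distrib sum_distrib_left[symmetric] TT using that by simp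
    finally show ?thesis
      by (simp add: power2_eq_square algebra_simps)
  qed
  have ge: "1 - a (Suc i) * T i i \<ge> 0" if "i < n" for i
  proof -
    have "0 \<le> (\<Sum>k<n. a (Suc k) * (t i k)\<^sup>2)"
      by (intro sum_nonneg mult_nonneg_nonneg) (auto intro: less_imp_le)
    then show ?thesis
      unfolding defect[OF that] using a_Suc_pos[of i] zero_le_mult_iff not_le by blast
  qed
  have "(\<Sum>i<n. a (Suc i) * T i i) = (\<Sum>x\<in>roots n. \<Sum>i<n. a (Suc i) * poly (E i) x * poly (E i) x / mass n x)"
    unfolding T_def sum_distrib_left by (subst sum.swap) (simp add: mult.assoc)
  also have "\<dots> = (\<Sum>x\<in>roots n. 1)"
    by (intro sum.cong refl)
      (simp add: sum_divide_distrib[symmetric] mass_def[symmetric] mult.assoc power2_eq_square[symmetric] nz)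
  also have "\<dots> = n"
    by (simp add: card_roots)
  finally have "(\<Sum>i<n. 1 - a (Suc i) * T i i) = 0"
    by (simp add: sum_subtractf)
  then have z: "1 - a (Suc i) * T i i = 0" if "i < n" for i
    by (subst (asm) sum_nonneg_eq_0_iff) (use ge that in \<open>simp_all add: lessThan_iff\<close>)
  have "(\<Sum>k<n. a (Suc k) * (t i k)\<^sup>2) = 0"
    unfolding defect[OF assms(1)] z[OF assms(1)] by simp
  then have "\<forall>k\<in>{..<n}. a (Suc k) * (t i k)\<^sup>2 = 0"
    by (subst (asm) sum_nonneg_eq_0_iff) (auto intro!: mult_nonneg_nonneg less_imp_le[OF a_Suc_pos])
  then have "a (Suc j) * (t i j)\<^sup>2 = 0"
    using assms(2) by blast
  then have "a (Suc i) * T i j = (if i = j then 1 else 0)"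
    by (simp add: t_def)
  then have "T i j = (if i = j then 1 else 0) / a (Suc i)"
    by (metis a_Suc_nz nonzero_mult_div_cancel_left)
  then show ?thesis
    unfolding T_def by simp
qed

section \<open>Spectral expansion of the energy form and bounds for the zeros\<close>

definition energy :: "nat \<Rightarrow> (nat \<Rightarrow> real) \<Rightarrow> real" where
  "energy n s = (\<Sum>k<n. (s k - s (Suc k))\<^sup>2 / b (Suc k))"

text \<open>Summation by parts moves the difference onto the flux, where the eigenvalue equation
  yields the factor \<open>x\<close>. Only the right end leaves a boundary term; the conditional
  guards against the truncated \<open>n - 1\<close>.\<close>

lemma sum_flux_by_parts:
  "(\<Sum>k<n. (s k - s (Suc k)) * flux k x) = x * (\<Sum>k<n. a (Suc k) * s k * poly (E k) x)
      - (if n = 0 then 0 else s n * flux (n - 1) x)"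
proof (induction n)
  case (Suc n)
  then show ?case
    by (cases n) (simp_all add: eigen_0 eigen_Suc algebra_simps del: E.simps(2,3))
qed simp

text \<open>Quadrature makes the root vectors a complete orthogonal system, in which both quadratic
  forms are diagonal.\<close>

lemma spectral_expansion:
  assumes s: "s n = 0"
  defines "c \<equiv> \<lambda>x. \<Sum>k<n. a (Suc k) * s k * poly (E k) x"
  shows "energy n s = (\<Sum>x\<in>roots n. x * (c x)\<^sup>2 / mass n x)"
    and "(\<Sum>k<n. a (Suc k) * (s k)\<^sup>2) = (\<Sum>x\<in>roots n. (c x)\<^sup>2 / mass n x)"
proof -
  \<comment> \<open>The last difference in the energy reaches index \<open>n\<close>. There
    quadrature says nothing, but both sides are zero: the left by \<open>s n = 0\<close>, the right
    because \<open>E n\<close> vanishes at its zeros.\<close>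
  have rec: "s k = (\<Sum>x\<in>roots n. c x / mass n x * poly (E k) x)" if "k \<le> n" for k
  proof (cases "k = n")
    case True
    then show ?thesis
      using s by (simp add: roots_def)
  next
    case False
    with that have k: "k < n" by simp
    have "(\<Sum>x\<in>roots n. c x / mass n x * poly (E k) x) =
        (\<Sum>x\<in>roots n. \<Sum>j<n. a (Suc j) * s j * (poly (E j) x * poly (E k) x / mass n x))"
      unfolding c_def sum_divide_distrib sum_distrib_right by (intro sum.cong refl) simp
    also have "\<dots> = (\<Sum>j<n. a (Suc j) * s j * (\<Sum>x\<in>roots n. poly (E j) x * poly (E k) x / mass n x))"
      unfolding sum_distrib_left by (rule sum.swap)
    also have "\<dots> = (\<Sum>j<n. if j = k then s j else 0)"
      by (intro sum.cong refl) (use quadrature[OF _ k] in simp)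
    finally show ?thesis
      using k by simp
  qed
  have "(\<Sum>k<n. a (Suc k) * (s k)\<^sup>2) = (\<Sum>k<n. a (Suc k) * s k * (\<Sum>x\<in>roots n. c x / mass n x * poly (E k) x))"
    by (intro sum.cong refl) (subst rec[symmetric], simp_all add: power2_eq_square)
  also have "\<dots> = (\<Sum>x\<in>roots n. c x / mass n x * (\<Sum>k<n. a (Suc k) * s k * poly (E k) x))"
    unfolding sum_distrib_left by (subst sum.swap) (intro sum.cong refl, simp)
  finally show "(\<Sum>k<n. a (Suc k) * (s k)\<^sup>2) = (\<Sum>x\<in>roots n. (c x)\<^sup>2 / mass n x)"
    by (simp add: c_def power2_eq_square)
  have "energy n s = (\<Sum>k<n. (s k - s (Suc k)) * (\<Sum>x\<in>roots n. c x / mass n x * flux k x))"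
    unfolding energy_def
  proof (intro sum.cong refl)
    fix k assume "k \<in> {..<n}"
    then have "s k - s (Suc k) = (\<Sum>x\<in>roots n. c x / mass n x * (poly (E k) x - poly (E (Suc k)) x))"
      using rec[of k] rec[of "Suc k"] by (simp add: right_diff_distrib sum_subtractf del: E.simps)
    also have "\<dots> = b (Suc k) * (\<Sum>x\<in>roots n. c x / mass n x * flux k x)"
      unfolding sum_distrib_left by (intro sum.cong refl) (simp add: flux_def del: E.simps)
    finally show "(s k - s (Suc k))\<^sup>2 / b (Suc k) = (s k - s (Suc k)) * (\<Sum>x\<in>roots n. c x / mass n x * flux k x)"
      by (simp add: power2_eq_square)
  qed
  also have "\<dots> = (\<Sum>x\<in>roots n. c x / mass n x * (\<Sum>k<n. (s k - s (Suc k)) * flux k x))"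
    unfolding sum_distrib_left by (subst sum.swap) (intro sum.cong refl, simp)
  also have "\<dots> = (\<Sum>x\<in>roots n. c x / mass n x * (x * c x))"
    by (intro sum.cong refl) (simp add: sum_flux_by_parts s c_def)
  finally show "energy n s = (\<Sum>x\<in>roots n. x * (c x)\<^sup>2 / mass n x)"
    by (simp add: power2_eq_square mult_ac)
qed

lemma energy_root:
  assumes "x \<in> roots n"
  shows "energy n (\<lambda>k. poly (E k) x) = x * mass n x"
proof -
  have "energy n (\<lambda>k. poly (E k) x) = (\<Sum>k<n. (poly (E k) x - poly (E (Suc k)) x) * flux k x)"
    unfolding energy_def by (intro sum.cong refl) (simp add: flux_def power2_eq_square del: E.simps)
  also have "\<dots> = x * mass n x"
    using assms by (subst sum_flux_by_parts) (simp add: roots_def mass_def power2_eq_square mult.assoc)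
  finally show ?thesis .
qed

text \<open>At a zero \<open>x\<close> the energy of the root vector is \<open>x\<close> times its
  mass. It is not zero, for otherwise all values up to index \<open>n\<close> would equal
  \<open>E 0 = 1\<close>, whereas the last one is 0.\<close>

lemma roots_pos:
  assumes "x \<in> roots n"
  shows "x > 0"
proof -
  have n: "n > 0"
    using assms by (cases n) (auto simp: roots_def)
  have nn: "(poly (E k) x - poly (E (Suc k)) x)\<^sup>2 / b (Suc k) \<ge> 0" for k
    by (simp add: less_imp_le)
  then have "energy n (\<lambda>k. poly (E k) x) \<ge> 0"
    unfolding energy_def by (intro sum_nonneg)
  moreover have "energy n (\<lambda>k. poly (E k) x) \<noteq> 0"
  proof
    assume "energy n (\<lambda>k. poly (E k) x) = 0"
    then have "\<forall>k<n. (poly (E k) x - poly (E (Suc k)) x)\<^sup>2 / b (Suc k) = 0"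
      unfolding energy_def by (subst (asm) sum_nonneg_eq_0_iff) (use nn in auto)
    then have *: "poly (E (Suc k)) x = poly (E k) x" if "k < n" for k
      using that by (simp del: E.simps)
    have "poly (E k) x = 1" if "k \<le> n" for k
      using that by (induction k) (simp_all add: * del: E.simps(2,3))
    then show False
      using assms by (simp add: roots_def)
  qed
  ultimately show ?thesis
    using energy_root[OF assms] mass_pos[OF n, of x] by (metis order_le_less zero_less_mult_pos2)
qed

text \<open>By \<open>(u - v)^2 \<le> 2 u^2 + 2 v^2\<close> each edge term is charged to its two
  endpoints. The hypotheses say that the total charge at each vertex is at most \<open>B\<close>
  times its weight.\<close>

lemma roots_bounded:
  assumes x: "x \<in> roots n"
    and B0: "2 / b 1 \<le> B * a 1"
    and B: "\<And>k. 2 * (1 / b (Suc k) + 1 / b (Suc (Suc k))) \<le> B * a (Suc (Suc k))"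
  shows "x \<le> B"
proof -
  have n: "n > 0"
    using x by (cases n) (auto simp: roots_def)
  \<comment> \<open>The extra term is the charge at the right end that is not yet paid for; it
    disappears when \<open>s n = 0\<close>.\<close>
  have *: "(\<Sum>k<n. (s k - s (Suc k))\<^sup>2 / b (Suc k)) \<le> B * (\<Sum>k<n. a (Suc k) * (s k)\<^sup>2)
      + (if n = 0 then 0 else 2 * (s n)\<^sup>2 / b n)" for s :: "nat \<Rightarrow> real"
  proof (induction n)
    case (Suc n)
    have "(s n - s (Suc n))\<^sup>2 \<le> 2 * ((s n)\<^sup>2 + (s (Suc n))\<^sup>2)"
      using zero_le_power2[of "s n + s (Suc n)"] by (simp add: power2_eq_square algebra_simps)
    then have "(s n - s (Suc n))\<^sup>2 / b (Suc n) \<le> 2 * ((s n)\<^sup>2 + (s (Suc n))\<^sup>2) / b (Suc n)"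
      by (intro divide_right_mono) (auto intro: less_imp_le)
    moreover have "2 * (s n)\<^sup>2 / b (Suc n) + (if n = 0 then 0 else 2 * (s n)\<^sup>2 / b n) \<le> B * (a (Suc n) * (s n)\<^sup>2)"
    proof (cases n)
      case 0
      then show ?thesis
        using mult_right_mono[OF B0 zero_le_power2[of "s n"]] by (simp add: mult.assoc)
    next
      case (Suc k)
      then show ?thesis
        using mult_right_mono[OF B[of k] zero_le_power2[of "s n"]] by (simp add: field_simps)
    qed
    ultimately show ?case
      using Suc by (simp add: algebra_simps add_divide_distrib)
  qed simp
  have "x * mass n x \<le> B * mass n x"
    using *[of "\<lambda>k. poly (E k) x"] n x
    by (subst energy_root[OF x, symmetric]) (simp add: energy_def mass_def roots_def)
  then show ?thesis
    using mass_pos[OF n, of x] by simp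
qed

section \<open>The smallest zero as a minimal Rayleigh quotient\<close>

lemma smallest_zero_Prec:
  assumes "n > 0"
  shows "smallest_zero (Prec a b n) \<in> roots n"
    and "x \<in> roots n \<Longrightarrow> smallest_zero (Prec a b n) \<le> x"
proof -
  have eq: "smallest_zero (Prec a b n) = Min (roots n)"
    by (simp add: smallest_zero_def roots_def roots_E_conv_Prec)
  have "roots n \<noteq> {}"
    using card_roots[of n] assms by auto
  then show "smallest_zero (Prec a b n) \<in> roots n"
    unfolding eq by (intro Min_in) auto
  show "x \<in> roots n \<Longrightarrow> smallest_zero (Prec a b n) \<le> x"
    unfolding eq by simp
qed

lemma smallest_zero_pos: "n > 0 \<Longrightarrow> smallest_zero (Prec a b n) > 0"
  using smallest_zero_Prec(1) roots_pos by blast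

lemma rayleigh_le:
  assumes "n > 0" and "s n = 0"
  shows "smallest_zero (Prec a b n) * (\<Sum>k<n. a (Suc k) * (s k)\<^sup>2) \<le> energy n s"
proof -
  define c where "c x = (\<Sum>k<n. a (Suc k) * s k * poly (E k) x)" for x
  have "smallest_zero (Prec a b n) * ((c x)\<^sup>2 / mass n x) \<le> x * (c x)\<^sup>2 / mass n x" if "x \<in> roots n" for x
    using mult_right_mono[OF smallest_zero_Prec(2)[OF assms(1) that], of "(c x)\<^sup>2 / mass n x"]
      mass_pos[OF assms(1), of x] by (simp add: less_imp_le)
  then have "(\<Sum>x\<in>roots n. smallest_zero (Prec a b n) * ((c x)\<^sup>2 / mass n x))
      \<le> (\<Sum>x\<in>roots n. x * (c x)\<^sup>2 / mass n x)"
    by (rule sum_mono)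
  then show ?thesis
    using spectral_expansion[of s n, OF assms(2)] by (simp add: c_def sum_distrib_left)
qed

text \<open>The minimiser is the root vector of the smallest zero. The normalisation
  \<open>s 0 = 1\<close> records that it is not the zero vector.\<close>

lemma rayleigh_attained:
  assumes "n > 0"
  obtains s where "s n = 0" "s 0 = 1"
    "energy n s = smallest_zero (Prec a b n) * (\<Sum>k<n. a (Suc k) * (s k)\<^sup>2)"
proof -
  let ?x = "smallest_zero (Prec a b n)"
  have x: "?x \<in> roots n"
    by (rule smallest_zero_Prec(1)[OF assms])
  show ?thesis
  proof (rule that[of "\<lambda>k. poly (E k) ?x"])
    show "poly (E n) ?x = 0"
      using x by (simp add: roots_def)
    show "energy n (\<lambda>k. poly (E k) ?x) = ?x * (\<Sum>k<n. a (Suc k) * (poly (E k) ?x)\<^sup>2)"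
      by (subst energy_root[OF x]) (simp add: mass_def)
  qed simp
qed


subsection \<open>The orthogonality measure\<close>

text \<open>The factor \<open>a (Suc 0)\<close> normalises the total mass to 1; \<open>distr\<close>
  along the identity transports the measure from the finite set of zeros to the Borel sets of the
  line.\<close>

definition quad_measure :: "nat \<Rightarrow> real measure" where
  "quad_measure n = distr (point_measure (roots n) (\<lambda>x. ennreal (a (Suc 0) / mass n x))) borel (\<lambda>x. x)"

lemma integral_quad_measure:
  assumes "n > 0" and [measurable]: "f \<in> borel_measurable borel"
  shows "integral\<^sup>L (quad_measure n) f = (\<Sum>x\<in>roots n. a (Suc 0) / mass n x * f x)"
proof -
  have "integral\<^sup>L (quad_measure n) f = integral\<^sup>L (point_measure (roots n) (\<lambda>x. ennreal (a (Suc 0) / mass n x))) f"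
    unfolding quad_measure_def by (rule integral_distr) (auto simp: measurable_point_measure_eq1)
  also have "\<dots> = (\<Sum>x\<in>roots n. a (Suc 0) / mass n x * f x)"
    using mass_pos[OF assms(1)]
    by (subst lebesgue_integral_point_measure_finite) (auto intro!: divide_nonneg_pos less_imp_le[OF a_Suc_pos])
  finally show ?thesis .
qed

lemma real_distribution_quad_measure:
  assumes n: "n > 0"
  shows "real_distribution (quad_measure n)"
proof -
  have "emeasure (quad_measure n) UNIV = (\<Sum>x\<in>roots n. ennreal (a (Suc 0) / mass n x))"
    unfolding quad_measure_def
    by (subst emeasure_distr) (auto simp: measurable_point_measure_eq1 space_point_measure emeasure_point_measure_finite)
  also have "\<dots> = ennreal (\<Sum>x\<in>roots n. a (Suc 0) / mass n x)"
    using mass_pos[OF n] by (intro sum_ennreal) (auto intro!: divide_nonneg_pos less_imp_le[OF a_Suc_pos])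
  also have "(\<Sum>x\<in>roots n. a (Suc 0) / mass n x) = a (Suc 0) * (\<Sum>x\<in>roots n. poly (E 0) x * poly (E 0) x / mass n x)"
    by (simp add: sum_distrib_left)
  also have "\<dots> = 1"
    using quadrature[OF n n] by simp
  finally have "emeasure (quad_measure n) UNIV = 1"
    by simp
  then have "prob_space (quad_measure n)"
    by (intro prob_spaceI) (simp add: quad_measure_def)
  then show ?thesis
    unfolding real_distribution_def real_distribution_axioms_def by (simp add: quad_measure_def)
qed

lemma quad_measure_support:
  assumes "n > 0" "A \<in> sets borel" "roots n \<subseteq> A"
  shows "measure (quad_measure n) A = 1"
proof -
  interpret real_distribution "quad_measure n"
    using assms(1) by (rule real_distribution_quad_measure)
  have "emeasure (quad_measure n) A = emeasure (quad_measure n) UNIV"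
    unfolding quad_measure_def using assms(2,3)
    by (subst (1 2) emeasure_distr)
      (auto simp: measurable_point_measure_eq1 space_point_measure intro!: arg_cong[where f = "emeasure _"])
  then show ?thesis
    by (metis measure_def prob_space space_eq_univ)
qed

lemma orthogonal_on_Rplus_Prec:
  assumes B0: "2 / b 1 \<le> B * a 1"
    and B: "\<And>k. 2 * (1 / b (Suc k) + 1 / b (Suc (Suc k))) \<le> B * a (Suc (Suc k))"
  shows "orthogonal_on_Rplus (Prec a b)"
proof -
  \<comment> \<open>The shift skips \<open>quad_measure 0\<close>, which has no atoms and is not a
    probability measure.\<close>
  define \<mu> where "\<mu> n = quad_measure (Suc n)" for n
  have roots: "roots n \<subseteq> {0..B}" for n
  proof
    fix x assume "x \<in> roots n"
    then show "x \<in> {0..B}"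
      using roots_bounded[OF _ B0 B, of x n] roots_pos[of x n] by simp
  qed
  have "0 < 2 / b 1"
    by simp
  also have "\<dots> \<le> B * a 1"
    by (rule B0)
  finally have Bpos: "B > 0"
    using a_Suc_pos[of 0] by (simp add: zero_less_mult_iff)
  have dist: "real_distribution (\<mu> n)" for n
    unfolding \<mu>_def by (rule real_distribution_quad_measure) simp
  have "tight \<mu>"
    unfolding tight_def
  proof (intro conjI allI impI)
    fix \<epsilon> :: real assume "\<epsilon> > 0"
    have "roots n \<subseteq> {-1<..B}" for n
      using roots[of n] by force
    then have "measure (\<mu> n) {-1<..B} = 1" for n
      unfolding \<mu>_def by (intro quad_measure_support) auto
    then show "\<exists>c d. c < d \<and> (\<forall>n. 1 - \<epsilon> < measure (\<mu> n) {c<..d})"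
      using \<open>\<epsilon> > 0\<close> Bpos by (intro exI[of _ "-1"] exI[of _ B]) simp
  qed (rule dist)
  then obtain r M where r: "strict_mono (r :: nat \<Rightarrow> nat)" and M: "real_distribution M"
    and conv: "weak_conv_m (\<mu> \<circ> id \<circ> r) M"
    using tight_imp_convergent_subsubsequence[of \<mu> id] by (auto simp: strict_mono_def)
  interpret M: real_distribution M by fact
  \<comment> \<open>Weak convergence tests bounded continuous functions only. Composition with
    \<open>clip\<close> makes a polynomial bounded and keeps its values at all zeros.\<close>
  define clip where "clip x = max 0 (min B x)" for x :: real
  have clip: "clip x \<in> {0..B}" "x \<in> {0..B} \<Longrightarrow> clip x = x" for x
    using Bpos by (auto simp: clip_def)
  have clip_root: "clip x = x" if "x \<in> roots n" for x n
    using that roots clip(2) by blast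
  have lim: "(\<lambda>n. integral\<^sup>L (\<mu> (r n)) (\<lambda>x. f (clip x))) \<longlonglongrightarrow> integral\<^sup>L M (\<lambda>x. f (clip x))"
    if f: "continuous_on {0..B} f" for f :: "real \<Rightarrow> real"
  proof -
    have "bounded (f ` {0..B})"
      by (intro compact_imp_bounded compact_continuous_image f) simp
    then obtain C where C: "\<And>x. x \<in> {0..B} \<Longrightarrow> norm (f x) \<le> C"
      unfolding bounded_iff by blast
    have "continuous_on UNIV (\<lambda>x. f (clip x))"
      by (rule continuous_on_compose2[OF f]) (use clip(1) in \<open>auto simp: clip_def intro!: continuous_intros\<close>)
    then have "isCont (\<lambda>x. f (clip x)) x" for x
      by (simp add: continuous_on_eq_continuous_at)
    then show ?thesis
      using weak_conv_imp_integral_bdd_continuous_conv[of "\<mu> \<circ> id \<circ> r" M "\<lambda>x. f (clip x)" C] conv dist M C clip(1)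
      by simp
  qed
  have AE: "AE x in M. x \<in> {0..B}"
  proof -
    \<comment> \<open>A bounded continuous function that vanishes exactly on \<open>{0..B}\<close>:
      its integrals against the quadrature measures are 0, hence so is the one against the limit,
      which confines the limit to \<open>{0..B}\<close>.\<close>
    define d where "d x = min 1 \<bar>x - clip x\<bar>" for x
    have cd: "continuous_on UNIV d"
      by (auto simp: d_def clip_def intro!: continuous_intros)
    then have [measurable]: "d \<in> borel_measurable borel"
      by (rule borel_measurable_continuous_onI)
    have "isCont d x" for x
      using cd by (simp add: continuous_on_eq_continuous_at)
    then have "(\<lambda>n. integral\<^sup>L (\<mu> (r n)) d) \<longlonglongrightarrow> integral\<^sup>L M d"
      using weak_conv_imp_integral_bdd_continuous_conv[of "\<mu> \<circ> id \<circ> r" M d 1] conv dist M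
      by (simp add: d_def)
    moreover have "integral\<^sup>L (\<mu> (r n)) d = 0" for n
      unfolding \<mu>_def by (subst integral_quad_measure) (auto simp: d_def clip_root)
    ultimately have "integral\<^sup>L M d = 0"
      by (simp add: LIMSEQ_const_iff)
    moreover have "integrable M d"
      by (rule M.integrable_const_bound[where B = 1]) (auto simp: d_def)
    ultimately have "AE x in M. d x = 0"
      by (subst (asm) integral_nonneg_eq_0_iff_AE) (auto simp: d_def)
    then show ?thesis
    proof eventually_elim
      case (elim x)
      then have "x = clip x"
        by (auto simp: d_def min_def split: if_splits)
      then show ?case
        using clip(1)[of x] by simp
    qed
  qed
  have poly_measurable: "poly p \<in> borel_measurable borel" for p :: "real poly"
    by (intro borel_measurable_continuous_onI continuous_intros)
  have int: "integrable M (poly p)" for p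
  proof -
    have "bounded (poly p ` {0..B})"
      by (intro compact_imp_bounded compact_continuous_image continuous_intros) simp
    then obtain C where C: "\<And>x. x \<in> {0..B} \<Longrightarrow> norm (poly p x) \<le> C"
      unfolding bounded_iff by blast
    have "AE x in M. norm (poly p x) \<le> C"
      using AE by eventually_elim (rule C)
    then show ?thesis
      by (rule M.integrable_const_bound) (simp add: poly_measurable)
  qed
  have limp: "(\<lambda>n. integral\<^sup>L (\<mu> (r n)) (poly p)) \<longlonglongrightarrow> integral\<^sup>L M (poly p)" for p
  proof -
    have "continuous_on UNIV (\<lambda>x. poly p (clip x))"
      unfolding clip_def by (intro continuous_intros)
    then have clip_measurable: "(\<lambda>x. poly p (clip x)) \<in> borel_measurable borel"
      by (rule borel_measurable_continuous_onI)
    have "integral\<^sup>L (\<mu> n) (poly p) = integral\<^sup>L (\<mu> n) (\<lambda>x. poly p (clip x))" for n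
      unfolding \<mu>_def by (simp add: clip_root integral_quad_measure poly_measurable clip_measurable)
    moreover have "integral\<^sup>L M (poly p) = integral\<^sup>L M (\<lambda>x. poly p (clip x))"
    proof (rule integral_cong_AE)
      show "AE x in M. poly p x = poly p (clip x)"
        using AE by eventually_elim (simp add: clip(2))
    qed (simp_all add: poly_measurable clip_measurable)
    ultimately show ?thesis
      using lim[of "poly p"] by (simp add: continuous_intros)
  qed
  have val: "integral\<^sup>L M (\<lambda>x. poly (E i) x * poly (E j) x) = (if i = j then a (Suc 0) / a (Suc j) else 0)" for i j
  proof -
    \<comment> \<open>As \<open>r n \<ge> n\<close>, both indices lie below \<open>Suc (r n)\<close>
      once \<open>n \<ge> max i j\<close>, and quadrature is then exact, so the sequence is
      eventually constant.\<close>
    have "eventually (\<lambda>n. integral\<^sup>L (\<mu> (r n)) (poly (E i * E j)) = (if i = j then a (Suc 0) / a (Suc j) else 0)) sequentially"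
      using eventually_ge_at_top[of "max i j"]
    proof eventually_elim
      case (elim n)
      then have ij: "i < Suc (r n)" "j < Suc (r n)"
        using seq_suble[OF r, of n] by auto
      have "integral\<^sup>L (\<mu> (r n)) (poly (E i * E j)) =
          a (Suc 0) * (\<Sum>x\<in>roots (Suc (r n)). poly (E i) x * poly (E j) x / mass (Suc (r n)) x)"
        unfolding \<mu>_def by (subst integral_quad_measure) (auto simp: sum_distrib_left poly_measurable)
      then show ?case
        using quadrature[OF ij] by simp
    qed
    then have "(\<lambda>n. integral\<^sup>L (\<mu> (r n)) (poly (E i * E j))) \<longlonglongrightarrow> (if i = j then a (Suc 0) / a (Suc j) else 0)"
      by (rule tendsto_eventually)
    then have "integral\<^sup>L M (poly (E i * E j)) = (if i = j then a (Suc 0) / a (Suc j) else 0)"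
      using limp LIMSEQ_unique by blast
    then show ?thesis
      by (simp only: poly_mult[abs_def])
  qed
  have P: "poly (Prec a b k) x = poly (E k) x / scl k" for k x
    using scl_nz[of k] by (simp add: poly_E_conv_Prec)
  have val': "integral\<^sup>L M (\<lambda>x. poly (Prec a b i) x * poly (Prec a b j) x) =
      (if i = j then a (Suc 0) / a (Suc j) / (scl j)\<^sup>2 else 0)" for i j
  proof -
    have "(\<lambda>x. poly (Prec a b i) x * poly (Prec a b j) x) =
        (\<lambda>x. 1 / (scl i * scl j) * (poly (E i) x * poly (E j) x))"
      by (simp add: P fun_eq_iff)
    then show ?thesis
      by (simp add: val power2_eq_square)
  qed
  have "AE x in M. x \<notin> {..<0}"
    using AE by eventually_elim auto
  then have "emeasure M {..<0} = 0"
    by (subst (asm) AE_iff_measurable[of "{..<0}"]) auto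
  moreover have "integrable M (\<lambda>x. poly (Prec a b i) x * poly (Prec a b j) x)" for i j
    using int[of "Prec a b i * Prec a b j"] by (simp only: poly_mult[abs_def])
  moreover have "integral\<^sup>L M (\<lambda>x. (poly (Prec a b k) x)\<^sup>2) > 0" for k
  proof -
    have "0 < a (Suc 0) / a (Suc k) / (scl k)\<^sup>2"
      using scl_nz[of k] by (intro divide_pos_pos) auto
    then show ?thesis
      using val'[of k k] by (simp add: power2_eq_square)
  qed
  ultimately show ?thesis
    unfolding orthogonal_on_Rplus_def using val'
    by (intro exI[of _ M]) simp
qed

end

section \<open>Gegenbauer polynomials\<close>

locale gegenbauer =
  fixes lam :: real
  assumes lam: "lam > -1/2"
begin

section \<open>The weighted integral as a positive functional on polynomials\<close>

definition L :: "real poly \<Rightarrow> real" where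
  "L p = (LBINT t:{-1<..<1}. w_lambda lam t * poly p t)"

lemma w_measurable [measurable]: "w_lambda lam \<in> borel_measurable borel"
  unfolding w_lambda_def by measurable

lemma w_nonneg: "w_lambda lam t \<ge> 0"
  by (simp add: w_lambda_def)

lemma one_minus_sq_nonneg: "t \<in> {-1..1} \<Longrightarrow> 0 \<le> 1 - t\<^sup>2" for t :: real
  using abs_square_le_1[of t] by (simp add: abs_le_iff)

lemma one_minus_sq_pos: "t \<in> {-1<..<1} \<Longrightarrow> 0 < 1 - t\<^sup>2" for t :: real
  using abs_square_less_1[of t] by (simp add: abs_less_iff)

text \<open>The endpoints are included thanks to the convention \<open>0 powr x = 0\<close>.\<close>

lemma w_mult: "t \<in> {-1..1} \<Longrightarrow> w_lambda lam t * (1 - t\<^sup>2) = (1 - t\<^sup>2) powr (lam + 1/2)"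
proof (cases "1 - t\<^sup>2 = 0")
  case False
  assume "t \<in> {-1..1}"
  with False have "0 < 1 - t\<^sup>2"
    using one_minus_sq_nonneg[of t] by simp
  then show ?thesis
    using powr_add[of "1 - t\<^sup>2" "lam - 1/2" 1] by (simp add: w_lambda_def add.commute)
qed (simp add: w_lambda_def)

lemma continuous_on_powr_weight: "continuous_on {-1..1::real} (\<lambda>t. (1 - t\<^sup>2) powr (lam + 1/2))"
proof (rule continuous_on_powr')
  have "0 < lam + 1/2"
    using lam by simp
  then show "\<forall>t\<in>{-1..1::real}. 0 \<le> 1 - t\<^sup>2 \<and> (1 - t\<^sup>2 = 0 \<longrightarrow> 0 < lam + 1/2)"
    using one_minus_sq_nonneg by blast
qed (intro continuous_intros)+

text \<open>The integrand is the derivative of \<open>(1 - t^2) powr (lam + 1/2) * poly p t\<close>,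
  which is continuous and zero at both endpoints. The gauge integral is used because integrability
  of the weight is itself derived from this identity.\<close>

lemma has_integral_pearson:
  "((\<lambda>t. w_lambda lam t * poly ([:1, 0, -1:] * pderiv p - smult (2 * lam + 1) ([:0, 1:] * p)) t)
     has_integral 0) {-1..1}"
proof -
  let ?F = "\<lambda>t. (1 - t\<^sup>2) powr (lam + 1/2) * poly p t"
  have "continuous_on {-1..1} ?F"
    by (intro continuous_on_mult continuous_on_powr_weight continuous_intros)
  moreover have "(?F has_vector_derivative
      w_lambda lam t * poly ([:1, 0, -1:] * pderiv p - smult (2 * lam + 1) ([:0, 1:] * p)) t) (at t)"
    if "t \<in> {-1<..<1}" for t
  proof -
    have pos: "0 < 1 - t\<^sup>2"
      using that by (rule one_minus_sq_pos)
    have "(?F has_real_derivative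
        ((lam + 1/2) * (1 - t\<^sup>2) powr (lam + 1/2 - 1) * (- 2 * t)) * poly p t
          + (1 - t\<^sup>2) powr (lam + 1/2) * poly (pderiv p) t) (at t)"
      using pos by (auto intro!: derivative_eq_intros)
    moreover have "((lam + 1/2) * (1 - t\<^sup>2) powr (lam + 1/2 - 1) * (- 2 * t)) * poly p t
          + (1 - t\<^sup>2) powr (lam + 1/2) * poly (pderiv p) t =
        w_lambda lam t * poly ([:1, 0, -1:] * pderiv p - smult (2 * lam + 1) ([:0, 1:] * p)) t"
    proof -
      have w: "(1 - t\<^sup>2) powr (lam + 1/2) = w_lambda lam t * (1 - t\<^sup>2)"
        using that by (intro w_mult[symmetric]) auto
      have "(1 - t\<^sup>2) powr (lam + 1/2 - 1) = w_lambda lam t"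
        by (simp add: w_lambda_def)
      then show ?thesis
        unfolding w by (simp add: algebra_simps power2_eq_square)
    qed
    ultimately show ?thesis
      by (simp add: has_real_derivative_iff_has_vector_derivative)
  qed
  ultimately have "((\<lambda>t. w_lambda lam t * poly ([:1, 0, -1:] * pderiv p - smult (2 * lam + 1) ([:0, 1:] * p)) t)
     has_integral (?F 1 - ?F (-1))) {-1..1}"
    by (intro fundamental_theorem_of_calculus_interior) auto
  then show ?thesis by simp
qed

text \<open>The weight may be unbounded at the endpoints. For \<open>p = t\<close> the Pearson
  integrand is \<open>w * (1 - (2 lam + 2) t^2)\<close>; subtracting it from the continuous function
  \<open>(2 lam + 2) * w * (1 - t^2)\<close> leaves \<open>(2 lam + 1) * w\<close>.\<close>

lemma w_set_integrable: "set_integrable lborel {-1<..<1} (w_lambda lam)"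
proof -
  have "(\<lambda>t. (1 - t\<^sup>2) powr (lam + 1/2)) integrable_on {-1..1::real}"
    by (rule integrable_continuous_real[OF continuous_on_powr_weight])
  then have "(\<lambda>t. ((2 * lam + 2) * (1 - t\<^sup>2) powr (lam + 1/2) -
      w_lambda lam t * poly ([:1, 0, -1:] * pderiv [:0, 1:] - smult (2 * lam + 1) ([:0, 1:] * [:0, 1:])) t)
      * (1 / (2 * lam + 1))) integrable_on {-1..1::real}"
    using has_integral_pearson[of "[:0, 1:]"]
    by (intro integrable_on_mult_left integrable_diff integrable_on_mult_right) (auto simp: integrable_on_def)
  moreover have "((2 * lam + 2) * (1 - t\<^sup>2) powr (lam + 1/2) -
      w_lambda lam t * poly ([:1, 0, -1:] * pderiv [:0, 1:] - smult (2 * lam + 1) ([:0, 1:] * [:0, 1:])) t)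
      * (1 / (2 * lam + 1)) = w_lambda lam t" if "t \<in> {-1..1}" for t
    unfolding w_mult[OF that, symmetric] using lam
    by (simp add: field_simps pderiv_pCons power2_eq_square)
  ultimately have "w_lambda lam integrable_on {-1..1}"
    by (rule integrable_eq)
  then have "w_lambda lam absolutely_integrable_on {-1..1}"
    by (intro nonnegative_absolutely_integrable_1) (auto simp: w_nonneg)
  then have "set_integrable lborel {-1..1} (w_lambda lam)"
    unfolding set_integrable_def by (subst (asm) integrable_completion) auto
  then show ?thesis
    by (rule set_integrable_subset) auto
qed

lemma w_poly_integrable: "set_integrable lborel {-1<..<1} (\<lambda>t. w_lambda lam t * poly p t)"
proof -
  have "bounded (poly p ` {-1..1})"
    by (intro compact_imp_bounded compact_continuous_image continuous_intros) simp
  then obtain C where C: "\<And>x. x \<in> {-1..1} \<Longrightarrow> norm (poly p x) \<le> C"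
    unfolding bounded_iff by blast
  have [measurable]: "poly p \<in> borel_measurable borel"
    by (intro borel_measurable_continuous_onI continuous_intros)
  have "norm (w_lambda lam t * poly p t) \<le> norm (C * w_lambda lam t)" if "t \<in> {-1<..<1}" for t
  proof -
    have "norm (w_lambda lam t * poly p t) = norm (poly p t) * w_lambda lam t"
      by (simp add: abs_mult w_nonneg)
    also have "\<dots> \<le> C * w_lambda lam t"
      using C[of t] that w_nonneg by (intro mult_right_mono) auto
    also have "\<dots> \<le> norm (C * w_lambda lam t)"
      by simp
    finally show ?thesis .
  qed
  then show ?thesis
    by (intro set_integrable_bound[OF set_integrable_mult_right[of C, OF w_set_integrable]])
      (auto simp: set_borel_measurable_def)
qed

lemma L_add: "L (p + q) = L p + L q"
  unfolding L_def by (simp add: distrib_left set_integral_add w_poly_integrable)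

lemma L_smult: "L (smult c p) = c * L p"
proof -
  have "L (smult c p) = (LBINT t:{-1<..<1}. c * (w_lambda lam t * poly p t))"
    unfolding L_def by (simp add: mult_ac)
  then show ?thesis
    by (simp only: set_integral_mult_right L_def)
qed

lemma L_0 [simp]: "L 0 = 0"
  using L_smult[of 0 0] by simp

lemma L_minus: "L (- p) = - L p"
  using L_smult[of "-1" p] by simp

lemma L_diff: "L (p - q) = L p - L q"
  using L_add[of p "-q"] by (simp add: L_minus)

lemma L_sum: "L (\<Sum>i\<in>I. f i) = (\<Sum>i\<in>I. L (f i))"
  by (induction I rule: infinite_finite_induct) (simp_all add: L_add)

lemma pearson: "L ([:1, 0, -1:] * pderiv p) = (2 * lam + 1) * L ([:0, 1:] * p)"
proof -
  let ?q = "[:1, 0, -1:] * pderiv p - smult (2 * lam + 1) ([:0, 1:] * p)"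
  have "L ?q = integral {-1<..<1} (\<lambda>t. w_lambda lam t * poly ?q t)"
    unfolding L_def by (rule set_borel_integral_eq_integral[OF w_poly_integrable])
  also have "\<dots> = integral {-1..1} (\<lambda>t. w_lambda lam t * poly ?q t)"
    by (rule integral_open_interval_real[symmetric])
  also have "\<dots> = 0"
    by (rule integral_unique[OF has_integral_pearson])
  finally show ?thesis
    by (simp only: L_diff L_smult)
qed

lemma L_square_pos:
  assumes "p \<noteq> 0"
  shows "L (p * p) > 0"
proof -
  let ?f = "\<lambda>t. indicator {-1<..<1} t *\<^sub>R (w_lambda lam t * poly (p * p) t)"
  have int: "integrable lborel ?f"
    using w_poly_integrable[of "p * p"] by (simp add: set_integrable_def)
  have nn: "?f t \<ge> 0" for t
    by (simp add: w_nonneg)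
  have "L (p * p) \<ge> 0"
    unfolding L_def set_lebesgue_integral_def using nn by (intro integral_nonneg_AE) auto
  moreover have "L (p * p) \<noteq> 0"
  proof
    assume "L (p * p) = 0"
    then have "AE t in lborel. ?f t = 0"
      unfolding L_def set_lebesgue_integral_def
      using integral_nonneg_eq_0_iff_AE[OF int] nn by simp
    moreover have "AE t in lborel. t \<notin> {t. poly p t = 0}"
      using assms by (intro AE_not_in finite_imp_null_set_lborel poly_roots_finite)
    ultimately have "AE t in lborel. t \<notin> {-1<..<1::real}"
    proof eventually_elim
      case (elim t)
      then show ?case
        using one_minus_sq_pos[of t] by (auto simp: w_lambda_def indicator_def split: if_splits)
    qed
    then have "emeasure lborel {-1<..<1::real} = 0"
      by (subst (asm) AE_iff_measurable[of "{-1<..<1}"]) auto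
    then show False by simp
  qed
  ultimately show ?thesis by simp
qed

lemma wnorm_poly: "wnorm lam (poly p) = sqrt (L (p * p))"
  by (simp add: wnorm_def L_def power2_eq_square)


text \<open>For \<open>k \<ge> 1\<close>, \<open>G k\<close> is \<open>C\<^sub>k / \<lambda>\<close>, which extends continuously to \<open>\<lambda> = 0\<close>; \<open>G 0\<close> is kept equal to \<open>1\<close>,
  so the recurrence for \<open>G 2\<close> is exceptional.\<close>

fun G :: "nat \<Rightarrow> real poly" where
  "G 0 = 1"
| "G (Suc 0) = [:0, 2:]"
| "G (Suc (Suc 0)) = [:-1, 0, 2 * (1 + lam):]"
| "G (Suc (Suc (Suc k))) = smult (1 / (real k + 3))
     (smult (2 * (real k + 2 + lam)) ([:0, 1:] * G (Suc (Suc k)))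
       - smult (real k + 1 + 2 * lam) (G (Suc k)))"

section \<open>Gegenbauer identities: derivatives, differential equation, orthogonality and
  norms\<close>

lemma G_rec:
  "(real k + 3) * poly (G (Suc (Suc (Suc k)))) x =
     2 * (real k + 2 + lam) * x * poly (G (Suc (Suc k))) x - (real k + 1 + 2 * lam) * poly (G (Suc k)) x"
  by (simp add: mult.assoc)

lemma G_rec_deriv:
  "(real k + 3) * poly (pderiv (G (Suc (Suc (Suc k))))) x =
     2 * (real k + 2 + lam) * (poly (G (Suc (Suc k))) x + x * poly (pderiv (G (Suc (Suc k)))) x)
     - (real k + 1 + 2 * lam) * poly (pderiv (G (Suc k))) x"
  by (simp add: pderiv_smult pderiv_diff pderiv_pCons) (simp add: algebra_simps)

declare G.simps(4) [simp del]

text \<open>The two identities need each other: the differentiated recurrence and the old lowering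
  rule give the new raising rule, and this with the old raising rule gives the new lowering
  rule.\<close>

lemma G_deriv_rules_aux:
  "x * poly (pderiv (G (Suc (Suc k)))) x - poly (pderiv (G (Suc k))) x = (real k + 2) * poly (G (Suc (Suc k))) x \<and>
   poly (pderiv (G (Suc (Suc k)))) x - x * poly (pderiv (G (Suc k))) x = (real k + 1 + 2 * lam) * poly (G (Suc k)) x"
proof (induction k)
  case 0
  then show ?case
    by (simp add: pderiv_pCons algebra_simps)
next
  case (Suc k)
  let ?d = "\<lambda>j. poly (pderiv (G j)) x" and ?g = "\<lambda>j. poly (G j) x"
  have A: "?d (Suc k) = x * ?d (Suc (Suc k)) - (real k + 2) * ?g (Suc (Suc k))"
    using Suc by simp
  have B: "(real k + 1 + 2 * lam) * ?g (Suc k) = ?d (Suc (Suc k)) - x * ?d (Suc k)"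
    using Suc by simp
  have "(real k + 3) * ?d (Suc (Suc (Suc k))) = (real k + 3) * (x * ?d (Suc (Suc k)) + (real k + 2 + 2 * lam) * ?g (Suc (Suc k)))"
    unfolding G_rec_deriv A by (simp add: algebra_simps)
  then have B': "?d (Suc (Suc (Suc k))) = x * ?d (Suc (Suc k)) + (real k + 2 + 2 * lam) * ?g (Suc (Suc k))"
    by simp
  have "x * ?d (Suc (Suc (Suc k))) - ?d (Suc (Suc k)) = (real k + 3) * ?g (Suc (Suc (Suc k)))"
    unfolding G_rec B B' A by (simp add: algebra_simps)
  with B' show ?case
    by (simp add: add_ac)
qed

lemma G_deriv_lower:
  "x * poly (pderiv (G (Suc k))) x - poly (pderiv (G k)) x = (real k + 1) * poly (G (Suc k)) x"
  using G_deriv_rules_aux[of x "k - 1"] by (cases k) (simp_all add: pderiv_pCons add_ac)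

lemma G_deriv_raise:
  "poly (pderiv (G (Suc (Suc k)))) x - x * poly (pderiv (G (Suc k))) x = (real k + 1 + 2 * lam) * poly (G (Suc k)) x"
  using G_deriv_rules_aux[of x k] by simp

text \<open>Lowering and raising rule added up. This is the identity that makes derivatives
  telescope.\<close>

lemma G_deriv_diff:
  "pderiv (G (Suc (Suc k))) - pderiv (G k) = smult (2 * (real k + 1 + lam)) (G (Suc k))"
proof (rule poly_ext)
  fix x
  show "poly (pderiv (G (Suc (Suc k))) - pderiv (G k)) x = poly (smult (2 * (real k + 1 + lam)) (G (Suc k))) x"
    using G_deriv_lower[of x k] G_deriv_raise[of k x] by (simp add: algebra_simps)
qed

lemma G_structure:
  "[:1, 0, -1:] * pderiv (G (Suc k)) =
     smult (real k + 1 + 2 * lam) ([:0, 1:] * G (Suc k)) - smult (real k + 2) (G (Suc (Suc k)))"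
proof (rule poly_ext)
  fix x
  let ?d = "\<lambda>j. poly (pderiv (G j)) x" and ?g = "\<lambda>j. poly (G j) x"
  have A: "(real k + 2) * ?g (Suc (Suc k)) = x * ?d (Suc (Suc k)) - ?d (Suc k)"
    using G_deriv_lower[of x "Suc k"] by (simp add: add_ac)
  have B: "?d (Suc (Suc k)) = x * ?d (Suc k) + (real k + 1 + 2 * lam) * ?g (Suc k)"
    using G_deriv_raise[of k x] by simp
  have "(1 - x * x) * ?d (Suc k) = (real k + 1 + 2 * lam) * (x * ?g (Suc k)) - (real k + 2) * ?g (Suc (Suc k))"
    unfolding A B by (simp add: algebra_simps)
  then show "poly ([:1, 0, -1:] * pderiv (G (Suc k))) x =
      poly (smult (real k + 1 + 2 * lam) ([:0, 1:] * G (Suc k)) - smult (real k + 2) (G (Suc (Suc k)))) x"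
    by (simp add: algebra_simps)
qed

text \<open>Differentiate \<open>G_structure\<close> and eliminate the derivative of index
  \<open>Suc (Suc j)\<close> by the raising rule.\<close>

lemma G_ode:
  "[:1, 0, -1:] * pderiv (pderiv (G k)) - smult (2 * lam + 1) ([:0, 1:] * pderiv (G k))
     = smult (- (real k * (real k + 2 * lam))) (G k)"
proof (cases k)
  case (Suc j)
  let ?G = "G (Suc j)"
  have "pderiv ([:1, 0, -1:] * pderiv ?G) =
      pderiv (smult (real j + 1 + 2 * lam) ([:0, 1:] * ?G) - smult (real j + 2) (G (Suc (Suc j))))"
    by (simp only: G_structure)
  then have *: "[:1, 0, -1:] * pderiv (pderiv ?G) + pderiv ?G * [:0, -2:] =
      smult (real j + 1 + 2 * lam) ([:0, 1:] * pderiv ?G + ?G) - smult (real j + 2) (pderiv (G (Suc (Suc j))))"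
    unfolding pderiv_mult pderiv_diff pderiv_smult by (simp add: pderiv_pCons)
  show ?thesis
  proof (rule poly_ext)
    fix x
    let ?d = "\<lambda>j. poly (pderiv (G j)) x" and ?g = "\<lambda>j. poly (G j) x"
    have B: "?d (Suc (Suc j)) = x * ?d (Suc j) + (real j + 1 + 2 * lam) * ?g (Suc j)"
      using G_deriv_raise[of j x] by simp
    have "(1 - x * x) * poly (pderiv (pderiv ?G)) x - 2 * x * ?d (Suc j) =
        (real j + 1 + 2 * lam) * (x * ?d (Suc j) + ?g (Suc j)) - (real j + 2) * ?d (Suc (Suc j))"
      using arg_cong[OF *, of "\<lambda>p. poly p x"] by (simp add: algebra_simps)
    then have "(1 - x * x) * poly (pderiv (pderiv ?G)) x - (2 * lam + 1) * (x * ?d (Suc j)) =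
        - ((real j + 1) * (real j + 1 + 2 * lam)) * ?g (Suc j)"
      unfolding B by (simp add: algebra_simps)
    then show "poly ([:1, 0, -1:] * pderiv (pderiv (G k)) - smult (2 * lam + 1) ([:0, 1:] * pderiv (G k))) x
        = poly (smult (- (real k * (real k + 2 * lam))) (G k)) x"
      unfolding Suc by (simp add: algebra_simps)
  qed
qed simp

text \<open>Self-adjointness of the Gegenbauer operator: the Pearson identity for
  \<open>q * pderiv (G k)\<close> together with the differential equation. For
  \<open>q = G i\<close> the right side is symmetric in both indices.\<close>

lemma L_G_eigen:
  "real k * (real k + 2 * lam) * L (q * G k) = L ([:1, 0, -1:] * pderiv q * pderiv (G k))"
proof -
  have "L ([:1, 0, -1:] * pderiv (q * pderiv (G k))) = (2 * lam + 1) * L ([:0, 1:] * (q * pderiv (G k)))"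
    by (rule pearson)
  moreover have "[:1, 0, -1:] * pderiv (q * pderiv (G k)) =
      [:1, 0, -1:] * pderiv q * pderiv (G k)
      + q * ([:1, 0, -1:] * pderiv (pderiv (G k)) - smult (2 * lam + 1) ([:0, 1:] * pderiv (G k)))
      + smult (2 * lam + 1) ([:0, 1:] * (q * pderiv (G k)))"
    by (rule poly_ext) (simp add: pderiv_mult algebra_simps)
  ultimately have "L ([:1, 0, -1:] * pderiv q * pderiv (G k))
      + L (q * smult (- (real k * (real k + 2 * lam))) (G k)) = 0"
    by (simp only: L_add L_smult G_ode)
  then show ?thesis
    by (simp only: mult_smult_right L_smult) simp
qed

text \<open>The eigenvalues differ by \<open>(j - i) * (i + j + 2 * lam)\<close>, and the second
  factor is positive because distinct indices have sum at least 1.\<close>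

lemma G_orthogonal:
  assumes "i \<noteq> j"
  shows "L (G i * G j) = 0"
proof -
  have "real j * (real j + 2 * lam) * L (G i * G j) = real i * (real i + 2 * lam) * L (G i * G j)"
    using L_G_eigen[of j "G i"] L_G_eigen[of i "G j"] by (simp only: mult_ac)
  then have "(real j - real i) * (real i + real j + 2 * lam) * L (G i * G j) = 0"
    by (simp add: algebra_simps)
  moreover have "real i + real j + 2 * lam > 0"
  proof -
    have "real i + real j \<ge> 1" using assms by linarith
    then show ?thesis using lam by linarith
  qed
  ultimately show ?thesis
    using assms by simp
qed

text \<open>Covers the exceptional recurrence for \<open>G 2\<close> together with the general one.
  The coefficient \<open>c\<close> stays unspecified because orthogonality removes its term.\<close>

lemma G_rec_weak:
  obtains c where "smult (real k + 2) (G (Suc (Suc k))) =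
    smult (2 * (real k + 1 + lam)) ([:0, 1:] * G (Suc k)) - smult c (G k)"
proof (cases k)
  case 0
  have "smult (real k + 2) (G (Suc (Suc k))) =
    smult (2 * (real k + 1 + lam)) ([:0, 1:] * G (Suc k)) - smult 2 (G k)"
    unfolding 0 by (rule poly_ext) (simp add: algebra_simps)
  then show ?thesis by (rule that)
next
  case (Suc j)
  have "smult (real k + 2) (G (Suc (Suc k))) =
    smult (2 * (real k + 1 + lam)) ([:0, 1:] * G (Suc k)) - smult (real j + 1 + 2 * lam) (G k)"
    unfolding Suc by (rule poly_ext) (use G_rec[of j] in \<open>simp add: algebra_simps\<close>)
  then show ?thesis by (rule that)
qed

text \<open>One mixed moment \<open>?M\<close> is evaluated twice: one recurrence is multiplied by
  \<open>G (Suc (Suc k))\<close>, the next one by \<open>G (Suc k)\<close>, and orthogonality leaves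
  a single norm in each.\<close>

lemma G_norm_rec:
  "(real k + 2) * (real k + 2 + lam) * L (G (Suc (Suc k)) * G (Suc (Suc k))) =
     (real k + 1 + lam) * (real k + 1 + 2 * lam) * L (G (Suc k) * G (Suc k))"
proof -
  let ?M = "L ([:0, 1:] * G (Suc k) * G (Suc (Suc k)))"
  obtain c where c: "smult (real k + 2) (G (Suc (Suc k))) =
      smult (2 * (real k + 1 + lam)) ([:0, 1:] * G (Suc k)) - smult c (G k)"
    by (rule G_rec_weak)
  have "smult (real k + 2) (G (Suc (Suc k)) * G (Suc (Suc k))) =
      smult (2 * (real k + 1 + lam)) ([:0, 1:] * G (Suc k) * G (Suc (Suc k))) - smult c (G k * G (Suc (Suc k)))"
    using arg_cong[OF c, of "\<lambda>p. p * G (Suc (Suc k))"] by (simp only: left_diff_distrib mult_smult_left)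
  then have "L (smult (real k + 2) (G (Suc (Suc k)) * G (Suc (Suc k)))) =
      L (smult (2 * (real k + 1 + lam)) ([:0, 1:] * G (Suc k) * G (Suc (Suc k))) - smult c (G k * G (Suc (Suc k))))"
    by (rule arg_cong)
  then have 1: "(real k + 2) * L (G (Suc (Suc k)) * G (Suc (Suc k))) = 2 * (real k + 1 + lam) * ?M"
    by (simp only: L_smult L_diff) (simp add: G_orthogonal)
  have "smult (real k + 3) (G (Suc (Suc (Suc k))) * G (Suc k)) =
      smult (2 * (real k + 2 + lam)) ([:0, 1:] * G (Suc k) * G (Suc (Suc k)))
      - smult (real k + 1 + 2 * lam) (G (Suc k) * G (Suc k))"
  proof (rule poly_ext)
    fix x
    have "(real k + 3) * poly (G (Suc (Suc (Suc k)))) x * poly (G (Suc k)) x =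
      (2 * (real k + 2 + lam) * x * poly (G (Suc (Suc k))) x - (real k + 1 + 2 * lam) * poly (G (Suc k)) x) * poly (G (Suc k)) x"
      by (simp only: G_rec)
    then show "poly (smult (real k + 3) (G (Suc (Suc (Suc k))) * G (Suc k))) x =
      poly (smult (2 * (real k + 2 + lam)) ([:0, 1:] * G (Suc k) * G (Suc (Suc k)))
        - smult (real k + 1 + 2 * lam) (G (Suc k) * G (Suc k))) x"
      by (simp add: algebra_simps)
  qed
  then have "L (smult (real k + 3) (G (Suc (Suc (Suc k))) * G (Suc k))) =
      L (smult (2 * (real k + 2 + lam)) ([:0, 1:] * G (Suc k) * G (Suc (Suc k)))
      - smult (real k + 1 + 2 * lam) (G (Suc k) * G (Suc k)))"
    by (rule arg_cong)
  then have 2: "2 * (real k + 2 + lam) * ?M = (real k + 1 + 2 * lam) * L (G (Suc k) * G (Suc k))"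
    by (simp only: L_smult L_diff) (simp add: G_orthogonal)
  have "(real k + 2) * (real k + 2 + lam) * L (G (Suc (Suc k)) * G (Suc (Suc k))) =
      (real k + 2 + lam) * ((real k + 2) * L (G (Suc (Suc k)) * G (Suc (Suc k))))"
    by (simp only: mult_ac)
  also have "\<dots> = (real k + 1 + lam) * (2 * (real k + 2 + lam) * ?M)"
    unfolding 1 by (simp only: mult_ac)
  finally show ?thesis
    unfolding 2 by (simp only: mult_ac)
qed

definition K :: real where
  "K = 2 * L 1 / Gamma (2 * lam + 1)"

lemma K_pos: "K > 0"
  unfolding K_def using L_square_pos[of 1] lam
  by (intro divide_pos_pos mult_pos_pos Gamma_real_pos) auto

lemma hsq_Suc:
  "hsq lam (Suc (Suc k)) =
     hsq lam (Suc k) * ((real k + 1 + lam) * (real k + 1 + 2 * lam)) / ((real k + 2) * (real k + 2 + lam))"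
proof -
  have nz: "real k + 1 + 2 * lam \<noteq> 0" "real k + 1 + lam \<noteq> 0" "real k + 2 + lam \<noteq> 0"
    using lam by auto
  have "Gamma (real k + 1 + 2 * lam + 1) = (real k + 1 + 2 * lam) * Gamma (real k + 1 + 2 * lam)"
    using nz lam by (intro Gamma_plus1) (auto dest: nonpos_Ints_nonpos)
  moreover have "Gamma (real k + 2 + 1) = (real k + 2) * Gamma (real k + 2)"
    by (intro Gamma_plus1) (auto dest: nonpos_Ints_nonpos)
  ultimately have "Gamma (real k + 1 + 2 * lam + 1) / ((real k + 2 + lam) * Gamma (real k + 2 + 1)) =
      Gamma (real k + 1 + 2 * lam) / ((real k + 1 + lam) * Gamma (real k + 2))
        * ((real k + 1 + lam) * (real k + 1 + 2 * lam)) / ((real k + 2) * (real k + 2 + lam))"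
    using nz by (simp add: mult_ac)
  moreover have "real (Suc (Suc k)) + 2 * lam = real k + 1 + 2 * lam + 1" "real (Suc (Suc k)) + 1 = real k + 2 + 1"
    "real (Suc k) + 2 * lam = real k + 1 + 2 * lam" "real (Suc k) + 1 = real k + 2"
    "real (Suc (Suc k)) + lam = real k + 2 + lam" "real (Suc k) + lam = real k + 1 + lam"
    by simp_all
  ultimately show ?thesis
    unfolding hsq_def by (simp only:)
qed

lemma hsq_pos: "hsq lam (Suc k) > 0"
  unfolding hsq_def using lam by (intro divide_pos_pos mult_pos_pos Gamma_real_pos) auto

lemma L_t_square: "(2 * lam + 2) * L [:0, 0, 1:] = L 1"
proof -
  have "L ([:1, 0, -1:] * pderiv [:0, 1:]) = (2 * lam + 1) * L ([:0, 1:] * [:0, 1:])"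
    by (rule pearson)
  moreover have "[:1, 0, -1:] * pderiv [:0, 1:] = 1 - [:0, 0, 1 :: real:]"
    by (simp add: pderiv_pCons one_pCons)
  moreover have "[:0, 1:] * [:0, 1:] = [:0, 0, 1 :: real:]"
    by simp
  ultimately have "L 1 - L [:0, 0, 1:] = (2 * lam + 1) * L [:0, 0, 1:]"
    by (simp only: L_diff)
  then show ?thesis
    by (simp add: algebra_simps)
qed

lemma G_norm: "L (G (Suc k) * G (Suc k)) = K * hsq lam (Suc k)"
proof (induction k)
  case 0
  have "G (Suc 0) * G (Suc 0) = smult 4 [:0, 0, 1:]"
    by simp
  then have "L (G (Suc 0) * G (Suc 0)) = 4 * L [:0, 0, 1:]"
    by (simp only: L_smult)
  moreover have "Gamma (2 * lam + 1) > 0"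
    using lam by (intro Gamma_real_pos) auto
  moreover have "1 + lam \<noteq> 0"
    using lam by auto
  ultimately have "L (G (Suc 0) * G (Suc 0)) * (1 + lam) = K * Gamma (2 * lam + 1)"
    by (simp add: K_def L_t_square[symmetric])
  moreover have "hsq lam (Suc 0) = Gamma (2 * lam + 1) / (1 + lam)"
    using Gamma_plus1[of "1::real"] by (simp add: hsq_def add.commute)
  ultimately show ?case
    using \<open>1 + lam \<noteq> 0\<close> by (metis nonzero_eq_divide_eq times_divide_eq_right)
next
  case (Suc k)
  have "(real k + 2) * (real k + 2 + lam) \<noteq> 0"
    using lam by auto
  then show ?case
    using G_norm_rec[of k] unfolding Suc hsq_Suc by (simp add: field_simps)
qed


section \<open>Both norms in telescoped coordinates\<close>

definition acoef :: "nat \<Rightarrow> real" where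
  "acoef j = (if j = 0 then Gamma (2 * lam + 1) / 2 else (real j + lam)\<^sup>2 * hsq lam j)"

definition H :: "nat \<Rightarrow> real poly" where
  "H j = smult (if j = 0 then 1 else real j + lam) (G j)"

lemma H_orthogonal: "i \<noteq> j \<Longrightarrow> L (H i * H j) = 0"
  by (simp add: H_def mult_smult_left mult_smult_right L_smult G_orthogonal)

text \<open>The special values of \<open>H 0\<close> and \<open>acoef 0\<close> allow one constant
  \<open>K\<close> for every index, also at \<open>lam = 0\<close>; it cancels in the Markov
  quotient.\<close>

lemma H_norm: "L (H j * H j) = K * acoef j"
proof (cases j)
  case 0
  have "Gamma (2 * lam + 1) > 0"
    using lam by (intro Gamma_real_pos) auto
  then show ?thesis
    by (simp add: H_def 0 acoef_def K_def flip: one_pCons)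
next
  case (Suc k)
  then show ?thesis
    by (simp add: H_def acoef_def L_smult G_norm power2_eq_square)
qed

lemma acoef_pos: "acoef j > 0"
proof (cases j)
  case 0
  have "Gamma (2 * lam + 1) > 0"
    using lam by (intro Gamma_real_pos) auto
  then show ?thesis
    by (simp add: 0 acoef_def)
next
  case (Suc k)
  then have "real j + lam \<noteq> 0"
    using lam by simp
  then show ?thesis
    using hsq_pos[of k] by (simp add: Suc acoef_def)
qed

lemma L_square_sum:
  assumes "finite I" and "\<And>i j. i \<in> I \<Longrightarrow> j \<in> I \<Longrightarrow> i \<noteq> j \<Longrightarrow> L (f i * f j) = 0"
  shows "L ((\<Sum>i\<in>I. smult (c i) (f i)) * (\<Sum>i\<in>I. smult (c i) (f i))) = (\<Sum>i\<in>I. (c i)\<^sup>2 * L (f i * f i))"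
proof -
  have "L ((\<Sum>i\<in>I. smult (c i) (f i)) * (\<Sum>i\<in>I. smult (c i) (f i))) =
      (\<Sum>i\<in>I. \<Sum>j\<in>I. c i * c j * L (f i * f j))"
    by (simp add: sum_product L_sum L_smult mult_ac)
  also have "\<dots> = (\<Sum>i\<in>I. \<Sum>j\<in>I. if i = j then (c i)\<^sup>2 * L (f i * f i) else 0)"
    by (intro sum.cong refl) (auto simp: assms(2) power2_eq_square)
  finally show ?thesis
    using assms(1) by simp
qed

text \<open>Collected by \<open>S j\<close>, the derivatives combine to
  \<open>pderiv (G (j + 1)) - pderiv (G (j - 1)) = 2 H j\<close>, with the second term absent for
  \<open>j = 0\<close>. The boundary terms vanish once \<open>S\<close> is zero from
  \<open>n\<close> on.\<close>

lemma pderiv_G_telescope: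
  "pderiv (\<Sum>k<n. smult (S k - S (Suc (Suc k))) (G (Suc k))) =
     (\<Sum>j<n. smult (2 * S j) (H j))
     - (if n = 0 then 0 else smult (S n) (pderiv (G (n - 1))) + smult (S (Suc n)) (pderiv (G n)))"
proof (induction n)
  case (Suc n)
  show ?case
  proof (cases n)
    case 0
    then show ?thesis
      by (simp add: H_def pderiv_smult pderiv_pCons one_pCons)
  next
    case (Suc m)
    have "smult 2 (H n) = pderiv (G (Suc n)) - pderiv (G m)"
      unfolding Suc G_deriv_diff by (simp add: H_def add_ac)
    then have "smult (2 * S n) (H n) = smult (S n) (pderiv (G (Suc n))) - smult (S n) (pderiv (G m))"
      by (metis mult.commute smult_diff_right smult_smult)
    then show ?thesis
      using Suc.IH by (simp add: Suc pderiv_add pderiv_diff pderiv_smult smult_diff_left)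
  qed
qed simp

lemma G_degree_aux: "degree (G k) \<le> k \<and> coeff (G k) k > 0"
proof (induction k rule: G.induct)
  case 3
  then show ?case using lam by (simp add: numeral_2_eq_2)
next
  case (4 k)
  have "degree (G (Suc (Suc (Suc k)))) \<le> Suc (Suc (Suc k))"
    unfolding G.simps(4) using 4
    by (intro order.trans[OF degree_smult_le] degree_diff_le order.trans[OF degree_mult_le]) auto
  moreover have "coeff (G (Suc k)) (Suc (Suc (Suc k))) = 0"
    using 4 by (intro coeff_eq_0) auto
  then have "coeff (G (Suc (Suc (Suc k)))) (Suc (Suc (Suc k))) =
      2 * (real k + 2 + lam) * coeff (G (Suc (Suc k))) (Suc (Suc k)) / (real k + 3)"
    unfolding G.simps(4) by simp
  moreover have "\<dots> > 0"
    using 4 lam by (intro divide_pos_pos mult_pos_pos) auto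
  ultimately show ?case by simp
qed simp_all

lemma degree_G_le: "degree (G k) \<le> k" and coeff_G_pos: "coeff (G k) k > 0"
  using G_degree_aux by auto

lemma G_expansion:
  assumes "degree p \<le> n"
  obtains c where "p = (\<Sum>k\<le>n. smult (c k) (G k))"
proof -
  have "\<exists>c. p = (\<Sum>k\<le>n. smult (c k) (G k))"
    using assms
  proof (induction n arbitrary: p)
    case 0
    then obtain d where "p = [:d:]"
      by (auto elim: degree_eq_zeroE)
    then show ?case
      by (intro exI[of _ "\<lambda>_. d"]) (simp add: one_pCons)
  next
    case (Suc n)
    define d where "d = coeff p (Suc n) / coeff (G (Suc n)) (Suc n)"
    let ?q = "p - smult d (G (Suc n))"
    have "coeff ?q i = 0" if "i > n" for i
    proof (cases "i = Suc n")
      case True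
      then show ?thesis
        using coeff_G_pos[of "Suc n"] by (simp add: d_def)
    next
      case False
      then show ?thesis
        using that Suc.prems degree_G_le[of "Suc n"] by (simp add: coeff_eq_0)
    qed
    then have "degree ?q \<le> n"
      by (intro degree_le) auto
    then obtain c where c: "?q = (\<Sum>k\<le>n. smult (c k) (G k))"
      using Suc.IH by blast
    have "p = (\<Sum>k\<le>Suc n. smult ((c(Suc n := d)) k) (G k))"
    proof -
      have "p = ?q + smult d (G (Suc n))"
        by simp
      then show ?thesis
        unfolding c by simp
    qed
    then show ?case by blast
  qed
  then show ?thesis
    using that by blast
qed

lemma norms_telescoped:
  assumes S: "\<And>j. j \<ge> n \<Longrightarrow> S j = 0"
  defines "p \<equiv> \<Sum>k<n. smult (S k - S (Suc (Suc k))) (G (Suc k))"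
  shows "L (pderiv p * pderiv p) = 4 * K * (\<Sum>j<n. acoef j * (S j)\<^sup>2)"
    and "L (p * p) = K * (\<Sum>k<n. hsq lam (Suc k) * (S k - S (Suc (Suc k)))\<^sup>2)"
    and "L (p * 1) = 0" and "degree p \<le> n"
proof -
  have "pderiv p = (\<Sum>j<n. smult (2 * S j) (H j))"
    unfolding p_def pderiv_G_telescope using S by simp
  then show "L (pderiv p * pderiv p) = 4 * K * (\<Sum>j<n. acoef j * (S j)\<^sup>2)"
    by (simp only:, subst L_square_sum)
      (simp_all add: H_orthogonal H_norm sum_distrib_left power_mult_distrib mult_ac)
  show "L (p * p) = K * (\<Sum>k<n. hsq lam (Suc k) * (S k - S (Suc (Suc k)))\<^sup>2)"
    unfolding p_def by (subst L_square_sum) (simp_all add: G_orthogonal G_norm sum_distrib_left mult_ac)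
  have "L (G (Suc k)) = 0" for k
    using G_orthogonal[of "Suc k" 0] by simp
  then show "L (p * 1) = 0"
    by (simp add: p_def L_sum L_smult)
  show "degree p \<le> n"
    unfolding p_def
    by (intro degree_sum_le order.trans[OF degree_smult_le] order.trans[OF degree_G_le]) auto
qed

text \<open>The second relation is only an inequality because a constant term enlarges the norm of
  \<open>p\<close> and leaves the derivative unchanged.\<close>

lemma norms_of_poly:
  assumes "degree p \<le> n"
  obtains S where "\<And>j. j \<ge> n \<Longrightarrow> S j = 0"
    and "L (pderiv p * pderiv p) = 4 * K * (\<Sum>j<n. acoef j * (S j)\<^sup>2)"
    and "K * (\<Sum>k<n. hsq lam (Suc k) * (S k - S (Suc (Suc k)))\<^sup>2) \<le> L (p * p)"
proof -
  obtain c where c: "p = (\<Sum>k\<le>n. smult (c k) (G k))"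
    using G_expansion[OF assms] .
  define d where "d k = (if k \<le> n then c k else 0)" for k
  \<comment> \<open>Padding the coefficients by zero makes \<open>n\<close> summands enough for
    every \<open>j\<close>.\<close>
  define S where "S j = (\<Sum>i<n. d (Suc (j + 2 * i)))" for j
  have S0: "S j = 0" if "j \<ge> n" for j
    using that by (auto simp: S_def d_def intro!: sum.neutral)
  have Sd: "S k - S (Suc (Suc k)) = d (Suc k)" for k
  proof -
    have "S k - S (Suc (Suc k)) = (\<Sum>i<n. d (Suc (k + 2 * i)) - d (Suc (k + 2 * Suc i)))"
      by (simp add: S_def sum_subtractf)
    also have "\<dots> = d (Suc k) - d (Suc (k + 2 * n))"
      by (subst sum_lessThan_telescope') simp
    finally show ?thesis
      by (simp add: d_def)
  qed
  define q where "q = (\<Sum>k<n. smult (S k - S (Suc (Suc k))) (G (Suc k)))"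
  have "p = (\<Sum>k<Suc n. smult (c k) (G k))"
    unfolding c by (simp add: lessThan_Suc_atMost)
  also have "\<dots> = smult (c 0) 1 + (\<Sum>k<n. smult (c (Suc k)) (G (Suc k)))"
    by (subst sum.lessThan_Suc_shift) simp
  also have "(\<Sum>k<n. smult (c (Suc k)) (G (Suc k))) = q"
    unfolding q_def Sd by (intro sum.cong refl) (simp add: d_def)
  finally have p: "p = smult (c 0) 1 + q" .
  have "pderiv p = pderiv q"
    by (simp add: p pderiv_add pderiv_smult)
  then have "L (pderiv p * pderiv p) = 4 * K * (\<Sum>j<n. acoef j * (S j)\<^sup>2)"
    using norms_telescoped(1)[of n S, OF S0] by (simp add: q_def)
  moreover have "L (p * p) = (c 0)\<^sup>2 * L (1 * 1) + L (q * q)"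
    using norms_telescoped(3)[of n S, OF S0]
    by (simp add: p q_def[symmetric] distrib_left distrib_right L_add L_smult power2_eq_square del: smult_one)
  then have "L (p * p) \<ge> L (q * q)"
    using L_square_pos[of 1] by simp
  then have "K * (\<Sum>k<n. hsq lam (Suc k) * (S k - S (Suc (Suc k)))\<^sup>2) \<le> L (p * p)"
    using norms_telescoped(2)[of n S, OF S0] by (simp add: q_def)
  ultimately show ?thesis
    using that S0 by blast
qed

end

section \<open>Comparison of Rayleigh quotients\<close>

text \<open>Summation by parts; the induction carries the stronger lower bound
  \<open>(\<Sum>k<m. x k) * f m\<close>.\<close>

lemma abel_nonneg:
  fixes x f :: "nat \<Rightarrow> real"
  assumes "\<And>j. j \<le> n \<Longrightarrow> 0 \<le> (\<Sum>k<j. x k)" and "\<And>k. k < n \<Longrightarrow> f (Suc k) \<le> f k" and "f n \<ge> 0"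
  shows "0 \<le> (\<Sum>k<n. x k * f k)"
proof -
  have "(\<Sum>k<m. x k) * f m \<le> (\<Sum>k<m. x k * f k)" if "m \<le> n" for m
    using that
  proof (induction m)
    case (Suc m)
    have "(\<Sum>k<Suc m. x k) * f (Suc m) \<le> (\<Sum>k<Suc m. x k) * f m"
      using Suc.prems assms(1)[of "Suc m"] assms(2)[of m] by (intro mult_left_mono) simp_all
    also have "\<dots> \<le> (\<Sum>k<Suc m. x k * f k)"
      using Suc by (simp add: distrib_right)
    finally show ?case .
  qed simp
  from this[of n] show ?thesis
    using mult_nonneg_nonneg[OF assms(1)[of n] assms(3)] by simp
qed

lemma tail_sum_Suc: "k < n \<Longrightarrow> (\<Sum>l\<in>{k..<n}. f l) = f k + (\<Sum>l\<in>{Suc k..<n}. f l)"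
  for f :: "nat \<Rightarrow> real"
  by (simp add: sum.atLeast_Suc_lessThan)

lemma abs_le_tail_variation:
  fixes s :: "nat \<Rightarrow> real"
  assumes "s n = 0" and "k \<le> n"
  shows "\<bar>s k\<bar> \<le> (\<Sum>l\<in>{k..<n}. \<bar>s l - s (Suc l)\<bar>)"
proof -
  have "s k = (\<Sum>l\<in>{k..<n}. s l - s (Suc l))"
    using sum_Suc_diff'[of k n s] assms by (simp add: sum_subtractf)
  then show ?thesis
    by (metis sum_abs)
qed

text \<open>The tail variation \<open>t\<close> of \<open>s\<close> is nonincreasing, dominates the
  absolute value of \<open>s\<close> and has differences of the same size. For such
  \<open>t\<close>, domination of the partial sums of the weights suffices.\<close>

lemma rayleigh_compare_mass:
  fixes \<alpha> \<gamma> \<alpha>' \<gamma>' s :: "nat \<Rightarrow> real"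
  assumes "s n = 0" and \<alpha>: "\<And>k. k < n \<Longrightarrow> \<alpha> k \<ge> 0"
    and \<gamma>: "\<And>k. k < n \<Longrightarrow> \<gamma>' k \<le> \<gamma> k"
    and mass: "\<And>j. j \<le> n \<Longrightarrow> (\<Sum>k<j. \<alpha> k) \<le> (\<Sum>k<j. \<alpha>' k)"
  obtains t where "t n = 0"
    "(\<Sum>k<n. \<alpha> k * (s k)\<^sup>2) \<le> (\<Sum>k<n. \<alpha>' k * (t k)\<^sup>2)"
    "(\<Sum>k<n. \<gamma>' k * (t k - t (Suc k))\<^sup>2) \<le> (\<Sum>k<n. \<gamma> k * (s k - s (Suc k))\<^sup>2)"
proof -
  define t where "t k = (\<Sum>l\<in>{k..<n}. \<bar>s l - s (Suc l)\<bar>)" for k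
  have t_nonneg: "t k \<ge> 0" for k
    by (simp add: t_def sum_nonneg)
  have diff: "t k = \<bar>s k - s (Suc k)\<bar> + t (Suc k)" if "k < n" for k
    unfolding t_def using that by (rule tail_sum_Suc)
  have "(\<Sum>k<n. \<alpha> k * (s k)\<^sup>2) \<le> (\<Sum>k<n. \<alpha> k * (t k)\<^sup>2)"
  proof (intro sum_mono mult_left_mono \<alpha>)
    fix k assume "k \<in> {..<n}"
    then show "(s k)\<^sup>2 \<le> (t k)\<^sup>2"
      using abs_le_tail_variation[of s n k] assms(1) t_nonneg[of k]
      by (metis abs_le_square_iff abs_of_nonneg lessThan_iff less_imp_le t_def)
  qed auto
  also have "0 \<le> (\<Sum>k<n. (\<alpha>' k - \<alpha> k) * (t k)\<^sup>2)"
    by (rule abel_nonneg) (use mass diff t_nonneg in \<open>auto simp: sum_subtractf intro!: power_mono\<close>)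
  then have "(\<Sum>k<n. \<alpha> k * (t k)\<^sup>2) \<le> (\<Sum>k<n. \<alpha>' k * (t k)\<^sup>2)"
    by (simp add: left_diff_distrib sum_subtractf)
  finally have "(\<Sum>k<n. \<alpha> k * (s k)\<^sup>2) \<le> (\<Sum>k<n. \<alpha>' k * (t k)\<^sup>2)" .
  moreover have "(\<Sum>k<n. \<gamma>' k * (t k - t (Suc k))\<^sup>2) \<le> (\<Sum>k<n. \<gamma> k * (s k - s (Suc k))\<^sup>2)"
    using \<gamma> by (intro sum_mono) (simp add: diff mult_right_mono)
  ultimately show ?thesis
    using that[of t] by (simp add: t_def)
qed

text \<open>Each difference of \<open>s\<close> is rescaled by
  \<open>sqrt (\<gamma> k / \<gamma>' k)\<close>, which keeps the energy. As \<open>t j\<close>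
  collects only differences of index at least \<open>j\<close>, the entries need comparing only for
  \<open>j \<le> k\<close>.\<close>

lemma rayleigh_compare_entries:
  fixes \<alpha> \<gamma> \<alpha>' \<gamma>' s :: "nat \<Rightarrow> real"
  assumes "s n = 0" and \<alpha>: "\<And>k. k < n \<Longrightarrow> \<alpha> k \<ge> 0" "\<And>k. k < n \<Longrightarrow> \<alpha>' k \<ge> 0"
    and \<gamma>: "\<And>k. k < n \<Longrightarrow> \<gamma> k > 0" "\<And>k. k < n \<Longrightarrow> \<gamma>' k > 0"
    and entries: "\<And>j k. j \<le> k \<Longrightarrow> k < n \<Longrightarrow> \<alpha> j * \<gamma>' k \<le> \<alpha>' j * \<gamma> k"
  obtains t where "t n = 0"
    "(\<Sum>k<n. \<alpha> k * (s k)\<^sup>2) \<le> (\<Sum>k<n. \<alpha>' k * (t k)\<^sup>2)"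
    "(\<Sum>k<n. \<gamma>' k * (t k - t (Suc k))\<^sup>2) \<le> (\<Sum>k<n. \<gamma> k * (s k - s (Suc k))\<^sup>2)"
proof -
  define r where "r k = sqrt (\<gamma> k / \<gamma>' k)" for k
  define t where "t k = (\<Sum>l\<in>{k..<n}. r l * \<bar>s l - s (Suc l)\<bar>)" for k
  have r_nonneg: "k < n \<Longrightarrow> r k \<ge> 0" for k
    using \<gamma>[of k] by (simp add: r_def)
  have diff: "t k = r k * \<bar>s k - s (Suc k)\<bar> + t (Suc k)" if "k < n" for k
    unfolding t_def using that by (rule tail_sum_Suc)
  have "\<alpha> k * (s k)\<^sup>2 \<le> \<alpha>' k * (t k)\<^sup>2" if k: "k < n" for k
  proof -
    have "sqrt (\<alpha> k) * \<bar>s k\<bar> \<le> sqrt (\<alpha> k) * (\<Sum>l\<in>{k..<n}. \<bar>s l - s (Suc l)\<bar>)"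
      using abs_le_tail_variation[of s n k] assms(1) k \<alpha> by (intro mult_left_mono) auto
    also have "\<dots> \<le> sqrt (\<alpha>' k) * t k"
      unfolding t_def sum_distrib_left
    proof (intro sum_mono)
      fix l assume l: "l \<in> {k..<n}"
      have "\<alpha> k \<le> \<alpha>' k * (\<gamma> l / \<gamma>' l)"
        using entries[of k l] \<gamma>[of l] l by (simp add: field_simps)
      then have "sqrt (\<alpha> k) \<le> sqrt (\<alpha>' k) * r l"
        unfolding r_def real_sqrt_mult[symmetric] by simp
      then show "sqrt (\<alpha> k) * \<bar>s l - s (Suc l)\<bar> \<le> sqrt (\<alpha>' k) * (r l * \<bar>s l - s (Suc l)\<bar>)"
        unfolding mult.assoc[symmetric] by (intro mult_right_mono) auto
    qed
    finally have "(sqrt (\<alpha> k) * \<bar>s k\<bar>)\<^sup>2 \<le> (sqrt (\<alpha>' k) * t k)\<^sup>2"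
      using \<alpha>(1)[OF k] by (intro power_mono) auto
    then show ?thesis
      using \<alpha>[OF k] by (simp add: power_mult_distrib)
  qed
  then have "(\<Sum>k<n. \<alpha> k * (s k)\<^sup>2) \<le> (\<Sum>k<n. \<alpha>' k * (t k)\<^sup>2)"
    by (intro sum_mono) auto
  moreover have "(\<Sum>k<n. \<gamma>' k * (t k - t (Suc k))\<^sup>2) \<le> (\<Sum>k<n. \<gamma> k * (s k - s (Suc k))\<^sup>2)"
  proof (intro sum_mono)
    fix k assume "k \<in> {..<n}"
    then have k: "k < n" by simp
    have "(r k)\<^sup>2 = \<gamma> k / \<gamma>' k"
      using \<gamma>[OF k] by (simp add: r_def)
    then show "\<gamma>' k * (t k - t (Suc k))\<^sup>2 \<le> \<gamma> k * (s k - s (Suc k))\<^sup>2"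
      using \<gamma>[OF k] by (simp add: diff[OF k] power_mult_distrib)
  qed
  ultimately show ?thesis
    using that[of t] by (simp add: t_def)
qed

context gegenbauer
begin

section \<open>Growth and monotonicity of the coefficients\<close>

definition D :: "nat \<Rightarrow> real" where
  "D i = Gamma (real i + 1 + 2 * lam) / (2 * Gamma (real i + 1))"

lemma D_pos: "D i > 0"
  unfolding D_def using lam by (intro divide_pos_pos mult_pos_pos Gamma_real_pos) auto

lemma acoef_0: "acoef 0 = D 0"
  by (simp add: acoef_def D_def add.commute)

text \<open>From \<open>2 (i + 1 + lam) = (i + 1 + 2 lam) + (i + 1)\<close> and the functional
  equation of \<open>Gamma\<close>. Sums of \<open>acoef\<close> over even and over odd indices thus
  both become sums of consecutive \<open>D\<close>.\<close>

lemma acoef_Suc: "acoef (Suc i) = D (Suc i) + D i"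
proof -
  let ?g = "Gamma (real i + 1 + 2 * lam)" and ?f = "Gamma (real i + 1)"
  have "Gamma (real i + 1 + 2 * lam + 1) = (real i + 1 + 2 * lam) * ?g"
    using lam by (intro Gamma_plus1) (auto dest: nonpos_Ints_nonpos)
  then have g: "Gamma (real i + 2 + 2 * lam) = (real i + 1 + 2 * lam) * ?g"
    by (simp add: add_ac)
  have "Gamma (real i + 1 + 1) = (real i + 1) * ?f"
    by (intro Gamma_plus1) (auto dest: nonpos_Ints_nonpos)
  then have f: "Gamma (real i + 2) = (real i + 1) * ?f"
    by (simp add: add_ac)
  have "?f > 0"
    by (intro Gamma_real_pos) simp
  then have nz: "?f \<noteq> 0" "real i + 1 + lam \<noteq> 0"
    using lam by linarith+
  have "acoef (Suc i) = (real i + 1 + lam)\<^sup>2 * (?g / ((real i + 1 + lam) * Gamma (real i + 2)))"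
    by (simp add: acoef_def hsq_def add_ac)
  also have "\<dots> = (real i + 1 + lam) * ?g / Gamma (real i + 2)"
    using nz by (simp add: power2_eq_square)
  also have "\<dots> = Gamma (real i + 2 + 2 * lam) / (2 * Gamma (real i + 2)) + ?g / (2 * ?f)"
    unfolding f g using nz by (simp add: divide_simps) (simp add: algebra_simps)
  also have "\<dots> = D (Suc i) + D i"
    by (simp add: D_def add_ac)
  finally show ?thesis .
qed

text \<open>Denominator minus numerator of the ratio factors as
  \<open>(1 - lam) * (2 k + 3 + 2 lam)\<close>.\<close>

lemma hsq_decreasing:
  assumes "lam \<le> 1"
  shows "hsq lam (Suc (Suc k)) \<le> hsq lam (Suc k)"
proof -
  have "(real k + 1 + lam) * (real k + 1 + 2 * lam) \<le> (real k + 2) * (real k + 2 + lam)"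
  proof -
    have "0 \<le> (1 - lam) * (2 * real k + 3 + 2 * lam)"
      using assms lam by (intro mult_nonneg_nonneg) auto
    then show ?thesis by (simp add: algebra_simps)
  qed
  moreover have "(real k + 2) * (real k + 2 + lam) > 0"
    using lam by (intro mult_pos_pos) auto
  ultimately have "((real k + 1 + lam) * (real k + 1 + 2 * lam)) / ((real k + 2) * (real k + 2 + lam)) \<le> 1"
    by simp
  then show ?thesis
    unfolding hsq_Suc times_divide_eq_right[symmetric] using hsq_pos[of k] mult_left_mono by fastforce
qed

text \<open>\<open>Gamma (i + 2 lam) / Gamma (i + 1)\<close> grows by exactly this factor.
  \<open>acoef\<close> multiplies it by the increasing \<open>i + lam\<close>, \<open>hsq\<close>
  divides by it, so the factor separates their growth rates.\<close>

lemma acoef_Suc_ratio: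
  assumes "lam \<ge> 0"
  shows "(real i + 2 * lam) / (real i + 1) * acoef i \<le> acoef (Suc i)"
proof (cases i)
  case 0
  have "Gamma (1 + 2 * lam + 1) = (1 + 2 * lam) * Gamma (1 + 2 * lam)"
    using lam by (intro Gamma_plus1) (auto dest: nonpos_Ints_nonpos)
  then have "D (Suc 0) = (1 + 2 * lam) * D 0"
    using Gamma_plus1[of "1::real"] by (simp add: D_def add_ac)
  then show ?thesis
    using D_pos[of 0] unfolding 0 by (simp add: acoef_0 acoef_Suc algebra_simps)
next
  case (Suc k)
  have pos: "real k + 1 + lam > 0" "real k + 2 + lam > 0" "real k + 1 + 2 * lam > 0"
    using assms by auto
  have "acoef (Suc i) = (real k + 2 + lam)\<^sup>2 * hsq lam (Suc (Suc k))"
    by (simp add: acoef_def Suc add_ac)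
  also have "\<dots> = (real k + 2 + lam) * (real k + 1 + lam) * ((real k + 1 + 2 * lam) / (real k + 2) * hsq lam (Suc k))"
    unfolding hsq_Suc using pos by (simp add: power2_eq_square)
  also have "\<dots> \<ge> (real k + 1 + lam) * (real k + 1 + lam) * ((real k + 1 + 2 * lam) / (real k + 2) * hsq lam (Suc k))"
    using pos hsq_pos[of k] by (intro mult_right_mono mult_nonneg_nonneg divide_nonneg_nonneg) auto
  finally show ?thesis
    unfolding Suc by (simp add: acoef_def power2_eq_square mult_ac add_ac)
qed

lemma hsq_Suc_ratio:
  assumes "lam \<ge> 0" "l > 0"
  shows "hsq lam (Suc l) \<le> (real l + 2 * lam) / (real l + 1) * hsq lam l"
proof -
  obtain k where k: "l = Suc k"
    using assms(2) by (cases l) auto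
  have pos: "real k + 1 + lam > 0" "real k + 2 + lam > 0" "real k + 1 + 2 * lam > 0"
    using assms by auto
  have "hsq lam (Suc l) = (real k + 1 + 2 * lam) / (real k + 2) * hsq lam l * ((real k + 1 + lam) / (real k + 2 + lam))"
    unfolding k hsq_Suc by (simp add: mult_ac)
  also have "\<dots> \<le> (real k + 1 + 2 * lam) / (real k + 2) * hsq lam l * 1"
    using pos hsq_pos[of k] k by (intro mult_left_mono mult_nonneg_nonneg divide_nonneg_nonneg) auto
  finally show ?thesis
    by (simp add: k add_ac)
qed

text \<open>The separating factor is \<open>1 + (2 lam - 1) / (x + 1)\<close>, nonincreasing in
  \<open>x\<close> for \<open>lam \<ge> 1/2\<close>, so its value at \<open>l\<close> may be
  replaced by that at \<open>i\<close>.\<close>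

lemma acoef_hsq_entries:
  assumes "lam \<ge> 1/2" "i \<le> l" "l > 0"
  shows "acoef i * hsq lam (Suc l) \<le> acoef (Suc i) * hsq lam l"
proof -
  have h: "hsq lam l > 0"
    using hsq_pos[of "l - 1"] assms(3) by simp
  have "acoef i * hsq lam (Suc l) \<le> acoef i * ((real l + 2 * lam) / (real l + 1) * hsq lam l)"
    using assms acoef_pos[of i] by (intro mult_left_mono hsq_Suc_ratio) auto
  also have "\<dots> = (real l + 2 * lam) / (real l + 1) * acoef i * hsq lam l"
    by (simp only: mult_ac)
  also have "\<dots> \<le> (real i + 2 * lam) / (real i + 1) * acoef i * hsq lam l"
  proof (intro mult_right_mono)
    have "(2 * lam - 1) * real i \<le> (2 * lam - 1) * real l"
      using assms by (intro mult_left_mono) auto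
    then show "(real l + 2 * lam) / (real l + 1) \<le> (real i + 2 * lam) / (real i + 1)"
      by (simp add: divide_simps) (simp add: algebra_simps)
  qed (use acoef_pos[of i] h in auto)
  also have "\<dots> \<le> acoef (Suc i) * hsq lam l"
    using assms acoef_Suc_ratio[of i] h by (intro mult_right_mono) auto
  finally show ?thesis .
qed

section \<open>The two parity classes as Jacobi matrices\<close>

lemma alpha_sq_Suc: "alpha_sq lam (Suc k) = acoef (2 * k + 1)"
  by (simp add: alpha_sq_def acoef_def add_ac)

lemma beta_sq_Suc: "beta_sq lam (Suc k) = 1 / hsq lam (2 * k + 2)"
  by (simp add: beta_sq_def)

lemma alpha_tilde_sq_Suc: "alpha_tilde_sq lam (Suc k) = acoef (2 * k)"
  by (simp add: alpha_tilde_sq_def acoef_def add_ac)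

lemma beta_tilde_sq_Suc: "beta_tilde_sq lam (Suc k) = 1 / hsq lam (2 * k + 1)"
  by (simp add: beta_tilde_sq_def)

sublocale P: jacobi_recurrence "alpha_sq lam" "beta_sq lam"
proof
  fix k :: nat assume "k \<ge> 1"
  then obtain j where "k = Suc j" by (cases k) auto
  then show "alpha_sq lam k > 0" "beta_sq lam k > 0"
    using acoef_pos hsq_pos[of "2 * j + 1"] by (simp_all add: alpha_sq_Suc beta_sq_Suc)
qed

sublocale T: jacobi_recurrence "alpha_tilde_sq lam" "beta_tilde_sq lam"
proof
  fix k :: nat assume "k \<ge> 1"
  then obtain j where "k = Suc j" by (cases k) auto
  then show "alpha_tilde_sq lam k > 0" "beta_tilde_sq lam k > 0"
    using acoef_pos hsq_pos[of "2 * j"] by (simp_all add: alpha_tilde_sq_Suc beta_tilde_sq_Suc)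
qed

definition mu :: "nat \<Rightarrow> real" where "mu m = smallest_zero (P_seq lam m)"
definition mu_tilde :: "nat \<Rightarrow> real" where "mu_tilde m = smallest_zero (P_tilde_seq lam m)"

lemma P_energy: "P.energy n s = (\<Sum>k<n. hsq lam (2 * k + 2) * (s k - s (Suc k))\<^sup>2)"
  by (simp add: P.energy_def beta_sq_Suc mult.commute)

lemma T_energy: "T.energy n s = (\<Sum>k<n. hsq lam (2 * k + 1) * (s k - s (Suc k))\<^sup>2)"
  by (simp add: T.energy_def beta_tilde_sq_Suc mult.commute)

lemma mu_pos: "m > 0 \<Longrightarrow> mu m > 0"
  unfolding mu_def P_seq_def by (rule P.smallest_zero_pos)

lemma mu_tilde_pos: "m > 0 \<Longrightarrow> mu_tilde m > 0"
  unfolding mu_tilde_def P_tilde_seq_def by (rule T.smallest_zero_pos)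

lemma mu_le:
  "m > 0 \<Longrightarrow> s m = 0 \<Longrightarrow> mu m * (\<Sum>k<m. acoef (2 * k + 1) * (s k)\<^sup>2) \<le>
     (\<Sum>k<m. hsq lam (2 * k + 2) * (s k - s (Suc k))\<^sup>2)"
  using P.rayleigh_le[of m s] by (simp add: P_energy alpha_sq_Suc mu_def P_seq_def)

lemma mu_tilde_le:
  "m > 0 \<Longrightarrow> s m = 0 \<Longrightarrow> mu_tilde m * (\<Sum>k<m. acoef (2 * k) * (s k)\<^sup>2) \<le>
     (\<Sum>k<m. hsq lam (2 * k + 1) * (s k - s (Suc k))\<^sup>2)"
  using T.rayleigh_le[of m s] by (simp add: T_energy alpha_tilde_sq_Suc mu_tilde_def P_tilde_seq_def)

lemma mu_attained:
  assumes "m > 0"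
  obtains s where "s m = 0" "s 0 = 1"
    "(\<Sum>k<m. hsq lam (2 * k + 2) * (s k - s (Suc k))\<^sup>2) = mu m * (\<Sum>k<m. acoef (2 * k + 1) * (s k)\<^sup>2)"
  using P.rayleigh_attained[OF assms] by (auto simp: P_energy alpha_sq_Suc mu_def P_seq_def)

lemma mu_tilde_attained:
  assumes "m > 0"
  obtains s where "s m = 0" "s 0 = 1"
    "(\<Sum>k<m. hsq lam (2 * k + 1) * (s k - s (Suc k))\<^sup>2) = mu_tilde m * (\<Sum>k<m. acoef (2 * k) * (s k)\<^sup>2)"
  using T.rayleigh_attained[OF assms] by (auto simp: T_energy alpha_tilde_sq_Suc mu_tilde_def P_tilde_seq_def)

section \<open>Interlacing of the two smallest zeros\<close>

lemma acoef_sum_pos: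
  fixes s :: "nat \<Rightarrow> real" and f :: "nat \<Rightarrow> nat"
  assumes "m > 0" "s 0 = 1"
  shows "(\<Sum>k<m. acoef (f k) * (s k)\<^sup>2) > 0"
  using assms acoef_pos by (intro sum_pos2[of _ 0]) (auto simp: less_imp_le)

lemma mu_le_mu_tilde:
  assumes m: "m > 0"
  shows "mu m \<le> mu_tilde m"
proof -
  obtain s where s: "s m = 0" "s 0 = 1" and
    eq: "(\<Sum>k<m. hsq lam (2 * k + 1) * (s k - s (Suc k))\<^sup>2) = mu_tilde m * (\<Sum>k<m. acoef (2 * k) * (s k)\<^sup>2)"
    using mu_tilde_attained[OF m] .
  obtain t where t: "t m = 0"
    "(\<Sum>k<m. acoef (2 * k) * (s k)\<^sup>2) \<le> (\<Sum>k<m. acoef (2 * k + 1) * (t k)\<^sup>2)"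
    "(\<Sum>k<m. hsq lam (2 * k + 2) * (t k - t (Suc k))\<^sup>2) \<le> (\<Sum>k<m. hsq lam (2 * k + 1) * (s k - s (Suc k))\<^sup>2)"
  proof (cases "lam \<le> 1")
    case True
    \<comment> \<open>For \<open>j > 0\<close> the odd indices sum to
      \<open>D 0 + ... + D (2 j - 1)\<close>, and the even ones to the same sum without its last
      term.\<close>
    have sums: "(\<Sum>k<j. acoef (2 * k + 1)) = (\<Sum>k<j. acoef (2 * k)) + (if j = 0 then 0 else D (2 * j - 1))" for j
    proof (induction j)
      case (Suc j)
      then show ?case
        by (cases j) (simp_all add: acoef_0 acoef_Suc)
    qed simp
    have mass: "(\<Sum>k<j. acoef (2 * k)) \<le> (\<Sum>k<j. acoef (2 * k + 1))" for j
      unfolding sums using D_pos[of "2 * j - 1"] by simp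
    show ?thesis
      by (rule rayleigh_compare_mass[of s m "\<lambda>k. acoef (2 * k)" "\<lambda>k. hsq lam (2 * k + 2)"
            "\<lambda>k. hsq lam (2 * k + 1)" "\<lambda>k. acoef (2 * k + 1)"])
        (use s hsq_decreasing[OF True] mass acoef_pos that in \<open>auto simp: less_imp_le\<close>)
  next
    case False
    show ?thesis
      by (rule rayleigh_compare_entries[of s m "\<lambda>k. acoef (2 * k)" "\<lambda>k. acoef (2 * k + 1)"
            "\<lambda>k. hsq lam (2 * k + 1)" "\<lambda>k. hsq lam (2 * k + 2)"])
        (use s False hsq_pos acoef_pos that acoef_hsq_entries in \<open>auto simp: less_imp_le\<close>)
  qed
  have "mu m * (\<Sum>k<m. acoef (2 * k) * (s k)\<^sup>2) \<le> mu m * (\<Sum>k<m. acoef (2 * k + 1) * (t k)\<^sup>2)"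
    using t(2) mu_pos[OF m] by simp
  also have "\<dots> \<le> mu_tilde m * (\<Sum>k<m. acoef (2 * k) * (s k)\<^sup>2)"
    using mu_le[of m t, OF m t(1)] t(3) eq by linarith
  finally show ?thesis
    using acoef_sum_pos[of m s "\<lambda>k. 2 * k", OF m s(2)] by simp
qed

lemma mu_tilde_Suc_le_mu:
  assumes m: "m > 0"
  shows "mu_tilde (Suc m) \<le> mu m"
proof -
  obtain s where s: "s m = 0" "s 0 = 1" and
    eq: "(\<Sum>k<m. hsq lam (2 * k + 2) * (s k - s (Suc k))\<^sup>2) = mu m * (\<Sum>k<m. acoef (2 * k + 1) * (s k)\<^sup>2)"
    using mu_attained[OF m] .
  \<comment> \<open>The weights of the tilde problem of size \<open>m + 1\<close> after its first
    two positions are merged, which brings it to size \<open>m\<close>.\<close>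
  define \<alpha>' where "\<alpha>' k = acoef (2 * k + 2) + (if k = 0 then acoef 0 else 0)" for k
  have \<alpha>'_ge: "acoef (Suc (Suc (2 * k))) \<le> \<alpha>' k" for k
    using acoef_pos[of 0] by (simp add: \<alpha>'_def)
  obtain t where t: "t m = 0"
    "(\<Sum>k<m. acoef (2 * k + 1) * (s k)\<^sup>2) \<le> (\<Sum>k<m. \<alpha>' k * (t k)\<^sup>2)"
    "(\<Sum>k<m. hsq lam (2 * k + 3) * (t k - t (Suc k))\<^sup>2) \<le> (\<Sum>k<m. hsq lam (2 * k + 2) * (s k - s (Suc k))\<^sup>2)"
  proof (cases "lam \<le> 1")
    case True
    have sums: "(\<Sum>k<j. \<alpha>' k) = (\<Sum>k<j. acoef (2 * k + 1)) + (if j = 0 then 0 else D (2 * j))" for j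
    proof (induction j)
      case (Suc j)
      then show ?case
        by (cases j) (simp_all add: acoef_0 acoef_Suc \<alpha>'_def numeral_2_eq_2)
    qed simp
    have mass: "(\<Sum>k<j. acoef (2 * k + 1)) \<le> (\<Sum>k<j. \<alpha>' k)" for j
      unfolding sums using D_pos[of "2 * j"] by simp
    show ?thesis
      by (rule rayleigh_compare_mass[of s m "\<lambda>k. acoef (2 * k + 1)" "\<lambda>k. hsq lam (2 * k + 3)"
            "\<lambda>k. hsq lam (2 * k + 2)" \<alpha>'])
        (use s hsq_decreasing[OF True] mass acoef_pos that in \<open>auto simp: less_imp_le numeral_3_eq_3\<close>)
  next
    case False
    have entries: "acoef (2 * j + 1) * hsq lam (2 * k + 3) \<le> \<alpha>' j * hsq lam (2 * k + 2)" if "j \<le> k" for j k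
    proof -
      have "acoef (2 * j + 1) * hsq lam (2 * k + 3) \<le> acoef (Suc (Suc (2 * j))) * hsq lam (2 * k + 2)"
        using acoef_hsq_entries[of "2 * j + 1" "2 * k + 2"] False that by (simp add: numeral_3_eq_3)
      also have "\<dots> \<le> \<alpha>' j * hsq lam (2 * k + 2)"
        using \<alpha>'_ge[of j] hsq_pos[of "Suc (2 * k)"] by (intro mult_right_mono) auto
      finally show ?thesis .
    qed
    have nonneg: "\<alpha>' k \<ge> 0" for k
      using \<alpha>'_ge[of k] acoef_pos[of "Suc (Suc (2 * k))"] by linarith
    show ?thesis
      by (rule rayleigh_compare_entries[of s m "\<lambda>k. acoef (2 * k + 1)" \<alpha>'
            "\<lambda>k. hsq lam (2 * k + 2)" "\<lambda>k. hsq lam (2 * k + 3)"])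
        (use s hsq_pos acoef_pos nonneg entries that in \<open>auto simp: less_imp_le numeral_3_eq_3\<close>)
  qed
  \<comment> \<open>Repeating the first entry kills the first difference, so \<open>t\<close> of length \<open>m\<close> is tested in length \<open>m + 1\<close>.\<close>
  define u where "u k = t (k - 1)" for k
  have "(\<Sum>k<Suc m. acoef (2 * k) * (u k)\<^sup>2) = acoef 0 * (t 0)\<^sup>2 + (\<Sum>k<m. acoef (2 * k + 2) * (t k)\<^sup>2)"
    by (subst sum.lessThan_Suc_shift) (simp add: u_def)
  also have "\<dots> = (\<Sum>k<m. (if k = 0 then acoef 0 * (t 0)\<^sup>2 else 0)) + (\<Sum>k<m. acoef (2 * k + 2) * (t k)\<^sup>2)"
    using m by simp
  also have "\<dots> = (\<Sum>k<m. \<alpha>' k * (t k)\<^sup>2)"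
    unfolding sum.distrib[symmetric] by (intro sum.cong refl) (simp add: \<alpha>'_def distrib_right)
  finally have 1: "(\<Sum>k<Suc m. acoef (2 * k) * (u k)\<^sup>2) = (\<Sum>k<m. \<alpha>' k * (t k)\<^sup>2)" .
  have 2: "(\<Sum>k<Suc m. hsq lam (2 * k + 1) * (u k - u (Suc k))\<^sup>2) = (\<Sum>k<m. hsq lam (2 * k + 3) * (t k - t (Suc k))\<^sup>2)"
    by (subst sum.lessThan_Suc_shift) (simp add: u_def numeral_3_eq_3)
  have "u (Suc m) = 0"
    using t(1) by (simp add: u_def)
  have "mu_tilde (Suc m) * (\<Sum>k<m. acoef (2 * k + 1) * (s k)\<^sup>2) \<le> mu_tilde (Suc m) * (\<Sum>k<m. \<alpha>' k * (t k)\<^sup>2)"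
    using t(2) mu_tilde_pos[of "Suc m"] by simp
  also have "\<dots> \<le> mu m * (\<Sum>k<m. acoef (2 * k + 1) * (s k)\<^sup>2)"
    using mu_tilde_le[of "Suc m" u, OF _ \<open>u (Suc m) = 0\<close>] t(3) eq unfolding 1 2 by linarith
  finally show ?thesis
    using acoef_sum_pos[of m s "\<lambda>k. 2 * k + 1", OF m s(2)] by simp
qed

end

section \<open>The Markov constant\<close>

lemma sum_even_odd:
  fixes f :: "nat \<Rightarrow> real"
  shows "(\<Sum>j<2 * m. f j) = (\<Sum>k<m. f (2 * k)) + (\<Sum>k<m. f (2 * k + 1))"
    and "(\<Sum>j<2 * m + 1. f j) = (\<Sum>k<Suc m. f (2 * k)) + (\<Sum>k<m. f (2 * k + 1))"
proof -
  show *: "(\<Sum>j<2 * m. f j) = (\<Sum>k<m. f (2 * k)) + (\<Sum>k<m. f (2 * k + 1))" for m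
    by (induction m) simp_all
  show "(\<Sum>j<2 * m + 1. f j) = (\<Sum>k<Suc m. f (2 * k)) + (\<Sum>k<m. f (2 * k + 1))"
    using *[of m] by simp
qed

context gegenbauer
begin

text \<open>In telescoped coordinates the squared quotient is at most \<open>4 / \<mu>\<close>, with
  \<open>\<mu>\<close> the attained minimum of the Rayleigh quotient; the polynomial built from the
  minimiser is extremal.\<close>

lemma markov_const_eq:
  assumes pos: "\<mu> > 0"
    and le: "\<And>S. (\<And>j. j \<ge> n \<Longrightarrow> S j = 0) \<Longrightarrow>
      \<mu> * (\<Sum>j<n. acoef j * (S j)\<^sup>2) \<le> (\<Sum>k<n. hsq lam (Suc k) * (S k - S (Suc (Suc k)))\<^sup>2)"
    and S: "\<And>j. j \<ge> n \<Longrightarrow> S j = 0" "(\<Sum>j<n. acoef j * (S j)\<^sup>2) > 0"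
      "(\<Sum>k<n. hsq lam (Suc k) * (S k - S (Suc (Suc k)))\<^sup>2) = \<mu> * (\<Sum>j<n. acoef j * (S j)\<^sup>2)"
  shows "markov_const n lam = 2 / sqrt \<mu>"
  unfolding markov_const_def
proof (rule cSup_eq_maximum)
  define p where "p = (\<Sum>k<n. smult (S k - S (Suc (Suc k))) (G (Suc k)))"
  define a where "a = (\<Sum>j<n. acoef j * (S j)\<^sup>2)"
  have dp: "L (pderiv p * pderiv p) = 4 * K * a" and pp: "L (p * p) = K * (\<mu> * a)" and deg: "degree p \<le> n"
    using norms_telescoped[of n S, OF S(1)] by (simp_all add: p_def S(3) a_def)
  have "a > 0"
    using S(2) by (simp add: a_def)
  then have "p \<noteq> 0"
    using pp K_pos pos by auto
  moreover have "2 / sqrt \<mu> = wnorm lam (poly (pderiv p)) / wnorm lam (poly p)"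
    unfolding wnorm_poly dp pp using K_pos \<open>a > 0\<close> pos by (simp add: real_sqrt_mult)
  ultimately show "2 / sqrt \<mu> \<in> {wnorm lam (poly (pderiv p)) / wnorm lam (poly p) |p. degree p \<le> n \<and> p \<noteq> 0}"
    using deg by blast
next
  fix x assume "x \<in> {wnorm lam (poly (pderiv p)) / wnorm lam (poly p) |p. degree p \<le> n \<and> p \<noteq> 0}"
  then obtain p where p: "degree p \<le> n" "p \<noteq> 0"
    and x: "x = wnorm lam (poly (pderiv p)) / wnorm lam (poly p)"
    by blast
  obtain S where S: "\<And>j. j \<ge> n \<Longrightarrow> S j = 0"
    and dp: "L (pderiv p * pderiv p) = 4 * K * (\<Sum>j<n. acoef j * (S j)\<^sup>2)"
    and pp: "K * (\<Sum>k<n. hsq lam (Suc k) * (S k - S (Suc (Suc k)))\<^sup>2) \<le> L (p * p)"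
    by (rule norms_of_poly[OF p(1)]) blast
  have "\<mu> * L (pderiv p * pderiv p) = 4 * (K * (\<mu> * (\<Sum>j<n. acoef j * (S j)\<^sup>2)))"
    unfolding dp by (simp add: mult_ac)
  also have "\<dots> \<le> 4 * L (p * p)"
    using order.trans[OF mult_left_mono[OF le[of S, OF S] less_imp_le[OF K_pos]] pp] by simp
  finally have "L (pderiv p * pderiv p) / L (p * p) \<le> 4 / \<mu>"
    using pos L_square_pos[OF p(2)] by (simp add: field_simps)
  then have "sqrt (L (pderiv p * pderiv p) / L (p * p)) \<le> sqrt (4 / \<mu>)"
    by (rule real_sqrt_le_mono)
  then show "x \<le> 2 / sqrt \<mu>"
    by (simp add: x wnorm_poly real_sqrt_divide)
qed

text \<open>For \<open>n = 2 m\<close> both parity classes have size \<open>m\<close>: even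
  positions of \<open>S\<close> carry the tilde problem, odd positions the plain one, and the latter
  has the smaller minimum.\<close>

lemma markov_const_even:
  assumes m: "m > 0"
  shows "markov_const (2 * m) lam = 2 / sqrt (mu m)"
proof -
  obtain s where s: "s m = 0" "s 0 = 1" and
    eq: "(\<Sum>k<m. hsq lam (2 * k + 2) * (s k - s (Suc k))\<^sup>2) = mu m * (\<Sum>k<m. acoef (2 * k + 1) * (s k)\<^sup>2)"
    using mu_attained[OF m] .
  \<comment> \<open>The minimiser sits on the odd positions. The cut-off is explicit since
    \<open>s\<close> is known to vanish only at \<open>m\<close> itself.\<close>
  define S where "S j = (if odd j \<and> j < 2 * m then s (j div 2) else 0)" for j
  have S_even: "S (2 * k) = 0" for k
    by (simp add: S_def)
  have S_odd: "S (2 * k + 1) = s k" if "k \<le> m" for k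
    using that s(1) by (cases "k = m") (auto simp: S_def)
  show ?thesis
  proof (rule markov_const_eq[where S = S])
    show "mu m > 0"
      using m by (rule mu_pos)
    fix R :: "nat \<Rightarrow> real" assume R: "\<And>j. j \<ge> 2 * m \<Longrightarrow> R j = 0"
    have "mu m * (\<Sum>j<2 * m. acoef j * (R j)\<^sup>2) =
        mu m * (\<Sum>k<m. acoef (2 * k) * (R (2 * k))\<^sup>2) + mu m * (\<Sum>k<m. acoef (2 * k + 1) * (R (2 * k + 1))\<^sup>2)"
      by (simp only: sum_even_odd distrib_left)
    also have "mu m * (\<Sum>k<m. acoef (2 * k) * (R (2 * k))\<^sup>2) \<le> mu_tilde m * (\<Sum>k<m. acoef (2 * k) * (R (2 * k))\<^sup>2)"
      using acoef_pos by (intro mult_right_mono mu_le_mu_tilde m sum_nonneg) (simp add: less_imp_le)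
    also have "mu_tilde m * (\<Sum>k<m. acoef (2 * k) * (R (2 * k))\<^sup>2) \<le>
        (\<Sum>k<m. hsq lam (2 * k + 1) * (R (2 * k) - R (2 * Suc k))\<^sup>2)"
      using m R by (intro mu_tilde_le) auto
    also have "mu m * (\<Sum>k<m. acoef (2 * k + 1) * (R (2 * k + 1))\<^sup>2) \<le>
        (\<Sum>k<m. hsq lam (2 * k + 2) * (R (2 * k + 1) - R (2 * Suc k + 1))\<^sup>2)"
      using m R by (intro mu_le) auto
    finally show "mu m * (\<Sum>j<2 * m. acoef j * (R j)\<^sup>2) \<le>
        (\<Sum>k<2 * m. hsq lam (Suc k) * (R k - R (Suc (Suc k)))\<^sup>2)"
      by (simp add: sum_even_odd)
  next
    have *: "(\<Sum>j<2 * m. acoef j * (S j)\<^sup>2) = (\<Sum>k<m. acoef (2 * k + 1) * (s k)\<^sup>2)"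
      unfolding sum_even_odd by (simp add: S_even S_odd[simplified])
    show "(\<Sum>j<2 * m. acoef j * (S j)\<^sup>2) > 0"
      unfolding * by (rule acoef_sum_pos[of m s "\<lambda>k. 2 * k + 1", OF m s(2)])
    have "(\<Sum>k<2 * m. hsq lam (Suc k) * (S k - S (Suc (Suc k)))\<^sup>2) =
        (\<Sum>k<m. hsq lam (2 * k + 1) * (S (2 * k) - S (2 * Suc k))\<^sup>2)
        + (\<Sum>k<m. hsq lam (2 * k + 2) * (S (2 * k + 1) - S (2 * Suc k + 1))\<^sup>2)"
      unfolding sum_even_odd by simp
    also have "\<dots> = (\<Sum>k<m. hsq lam (2 * k + 2) * (s k - s (Suc k))\<^sup>2)"
      unfolding S_even by (simp add: S_odd del: mult_Suc_right add_Suc_right One_nat_def Suc_eq_plus1_left)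
    finally show "(\<Sum>k<2 * m. hsq lam (Suc k) * (S k - S (Suc (Suc k)))\<^sup>2) = mu m * (\<Sum>j<2 * m. acoef j * (S j)\<^sup>2)"
      unfolding * eq .
  qed (simp add: S_def)
qed

text \<open>For \<open>n = 2 m + 1\<close> the even positions form the tilde problem of size
  \<open>m + 1\<close> and the odd ones the plain problem of size \<open>m\<close>. Now the tilde
  problem has the smaller minimum.\<close>

lemma markov_const_odd:
  "markov_const (2 * m + 1) lam = 2 / sqrt (mu_tilde (Suc m))"
proof -
  obtain s where s: "s (Suc m) = 0" "s 0 = 1" and
    eq: "(\<Sum>k<Suc m. hsq lam (2 * k + 1) * (s k - s (Suc k))\<^sup>2) = mu_tilde (Suc m) * (\<Sum>k<Suc m. acoef (2 * k) * (s k)\<^sup>2)"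
    using mu_tilde_attained[of "Suc m"] by blast
  define S where "S j = (if even j \<and> j < 2 * m + 1 then s (j div 2) else 0)" for j
  have S_odd: "S (2 * k + 1) = 0" for k
    by (simp add: S_def)
  have S_even: "S (2 * k) = s k" if "k \<le> Suc m" for k
    using that s(1) by (cases "k = Suc m") (auto simp: S_def)
  show ?thesis
  proof (rule markov_const_eq[where S = S])
    show "mu_tilde (Suc m) > 0"
      by (rule mu_tilde_pos) simp
    fix R :: "nat \<Rightarrow> real" assume R: "\<And>j. j \<ge> 2 * m + 1 \<Longrightarrow> R j = 0"
    have *: "mu_tilde (Suc m) * (\<Sum>k<m. acoef (2 * k + 1) * (R (2 * k + 1))\<^sup>2) \<le>
        (\<Sum>k<m. hsq lam (2 * k + 2) * (R (2 * k + 1) - R (2 * Suc k + 1))\<^sup>2)"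
    \<comment> \<open>For \<open>m = 0\<close> the odd class is empty, so there is no plain problem
      to compare with.\<close>
    proof (cases "m = 0")
      case False
      then have m: "m > 0" by simp
      have "mu_tilde (Suc m) * (\<Sum>k<m. acoef (2 * k + 1) * (R (2 * k + 1))\<^sup>2) \<le> mu m * (\<Sum>k<m. acoef (2 * k + 1) * (R (2 * k + 1))\<^sup>2)"
        using acoef_pos by (intro mult_right_mono mu_tilde_Suc_le_mu m sum_nonneg) (simp add: less_imp_le)
      also have "\<dots> \<le> (\<Sum>k<m. hsq lam (2 * k + 2) * (R (2 * k + 1) - R (2 * Suc k + 1))\<^sup>2)"
        using m R by (intro mu_le) auto
      finally show ?thesis .
    qed simp
    have "mu_tilde (Suc m) * (\<Sum>j<2 * m + 1. acoef j * (R j)\<^sup>2) =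
        mu_tilde (Suc m) * (\<Sum>k<Suc m. acoef (2 * k) * (R (2 * k))\<^sup>2)
        + mu_tilde (Suc m) * (\<Sum>k<m. acoef (2 * k + 1) * (R (2 * k + 1))\<^sup>2)"
      by (simp only: sum_even_odd distrib_left)
    also have "mu_tilde (Suc m) * (\<Sum>k<Suc m. acoef (2 * k) * (R (2 * k))\<^sup>2) \<le>
        (\<Sum>k<Suc m. hsq lam (2 * k + 1) * (R (2 * k) - R (2 * Suc k))\<^sup>2)"
      using R by (intro mu_tilde_le) auto
    also note *
    finally show "mu_tilde (Suc m) * (\<Sum>j<2 * m + 1. acoef j * (R j)\<^sup>2) \<le>
        (\<Sum>k<2 * m + 1. hsq lam (Suc k) * (R k - R (Suc (Suc k)))\<^sup>2)"
      unfolding sum_even_odd by simp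
  next
    have *: "(\<Sum>j<2 * m + 1. acoef j * (S j)\<^sup>2) = (\<Sum>k<Suc m. acoef (2 * k) * (s k)\<^sup>2)"
      unfolding sum_even_odd S_odd by (simp add: S_even)
    show "(\<Sum>j<2 * m + 1. acoef j * (S j)\<^sup>2) > 0"
      unfolding * by (rule acoef_sum_pos[of "Suc m" s "\<lambda>k. 2 * k", OF _ s(2)]) simp
    have "(\<Sum>k<2 * m + 1. hsq lam (Suc k) * (S k - S (Suc (Suc k)))\<^sup>2) =
        (\<Sum>k<Suc m. hsq lam (2 * k + 1) * (S (2 * k) - S (2 * Suc k))\<^sup>2)
        + (\<Sum>k<m. hsq lam (2 * k + 2) * (S (2 * k + 1) - S (2 * Suc k + 1))\<^sup>2)"
      unfolding sum_even_odd by simp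
    also have "\<dots> = (\<Sum>k<Suc m. hsq lam (2 * k + 1) * (s k - s (Suc k))\<^sup>2)"
      unfolding S_odd by (simp add: S_even del: mult_Suc_right sum.lessThan_Suc)
    finally show "(\<Sum>k<2 * m + 1. hsq lam (Suc k) * (S k - S (Suc (Suc k)))\<^sup>2) = mu_tilde (Suc m) * (\<Sum>j<2 * m + 1. acoef j * (S j)\<^sup>2)"
      unfolding * eq .
  qed (simp add: S_def)
qed

section \<open>Uniform bounds on the matrix entries and existence of the orthogonality
  measures\<close>

lemma hsq_Suc_le_acoef: "hsq lam (Suc (Suc i)) \<le> acoef (Suc i)"
proof -
  have pos: "real i + 1 + lam > 0" "real i + 2 + lam > 1"
    using lam by auto
  have "real i + 1 + 2 * lam \<le> (real i + 1 + lam) * 2"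
    by simp
  also have "\<dots> \<le> (real i + 1 + lam) * ((real i + 2) * (real i + 2 + lam))"
    using pos mult_mono[of 2 "real i + 2" 1 "real i + 2 + lam"] by (intro mult_left_mono) auto
  finally have "(real i + 1 + lam) * (real i + 1 + 2 * lam) \<le>
      (real i + 1 + lam) * ((real i + 1 + lam) * ((real i + 2) * (real i + 2 + lam)))"
    using pos by (intro mult_left_mono) auto
  then have "(real i + 1 + lam) * (real i + 1 + 2 * lam) / ((real i + 2) * (real i + 2 + lam)) \<le> (real i + 1 + lam)\<^sup>2"
    using pos by (subst pos_divide_le_eq) (auto simp: power2_eq_square mult_ac)
  then have "hsq lam (Suc i) * ((real i + 1 + lam) * (real i + 1 + 2 * lam) / ((real i + 2) * (real i + 2 + lam)))
      \<le> hsq lam (Suc i) * (real i + 1 + lam)\<^sup>2"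
    using hsq_pos[of i] by (intro mult_left_mono) auto
  then show ?thesis
    by (simp add: hsq_Suc acoef_def mult_ac add_ac)
qed

text \<open>The quotient of the two sides splits into three factors, each at least 1; two of them
  absorb a factor 2, the third the division by \<open>1 + 2 * lam\<close>.\<close>

lemma hsq_le_acoef_Suc: "hsq lam (Suc i) \<le> 4 / (1 + 2 * lam) * acoef (Suc (Suc i))"
proof -
  have pos: "real i + 1 + lam > 0" "real i + 2 + lam > 0" "1 + 2 * lam > 0"
    using lam by auto
  have ge1: "1 \<le> x * y" if "1 \<le> x" "1 \<le> y" for x y :: real
    using mult_mono[of 1 x 1 y] that by simp
  have "1 \<le> ((real i + 2 + lam) * 2 / (real i + 2)) * ((real i + 1 + lam) * 2) * ((real i + 1 + 2 * lam) / (1 + 2 * lam))"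
  proof -
    have "1 \<le> (real i + 2 + lam) * 2 / (real i + 2)" "1 \<le> (real i + 1 + lam) * 2" "1 \<le> (real i + 1 + 2 * lam) / (1 + 2 * lam)"
      using lam by (simp_all add: field_simps)
    then show ?thesis
      by (rule ge1[OF ge1])
  qed
  then have "hsq lam (Suc i) * 1 \<le> hsq lam (Suc i) *
     (((real i + 2 + lam) * 2 / (real i + 2)) * ((real i + 1 + lam) * 2) * ((real i + 1 + 2 * lam) / (1 + 2 * lam)))"
    using hsq_pos[of i] by (intro mult_left_mono) auto
  also have "\<dots> = 4 / (1 + 2 * lam) * ((real i + 2 + lam)\<^sup>2 * hsq lam (Suc (Suc i)))"
    using pos by (simp add: hsq_Suc power2_eq_square) (simp add: algebra_simps)
  finally show ?thesis
    by (simp add: acoef_def add_ac)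
qed

lemma orthogonal_P: "orthogonal_on_Rplus (P_seq lam)" and orthogonal_P_tilde: "orthogonal_on_Rplus (P_tilde_seq lam)"
proof -
  \<comment> \<open>The sum dominates the three constants at once: those of the two entry bounds and
    the ratio at index 0, which \<open>hsq_Suc_le_acoef\<close> does not reach.\<close>
  define C where "C = 1 + 4 / (1 + 2 * lam) + hsq lam 1 / acoef 0"
  have pos: "4 / (1 + 2 * lam) > 0" "hsq lam 1 / acoef 0 > 0"
    using lam hsq_pos[of 0] acoef_pos[of 0] by (auto intro!: divide_pos_pos)
  have C_ge: "1 \<le> C" "4 / (1 + 2 * lam) \<le> C" "hsq lam 1 / acoef 0 \<le> C"
    using pos by (simp_all add: C_def)
  have up: "hsq lam (Suc i) \<le> C * acoef i" for i
  proof (cases i)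
    case 0
    have "hsq lam (Suc i) = hsq lam 1 / acoef 0 * acoef i"
      using acoef_pos[of 0] by (simp add: 0)
    also have "\<dots> \<le> C * acoef i"
      using C_ge(3) acoef_pos[of i] by (intro mult_right_mono) auto
    finally show ?thesis .
  next
    case (Suc j)
    have "hsq lam (Suc i) \<le> 1 * acoef i"
      using hsq_Suc_le_acoef[of j] by (simp add: Suc)
    also have "\<dots> \<le> C * acoef i"
      using C_ge(1) acoef_pos[of i] by (intro mult_right_mono) auto
    finally show ?thesis .
  qed
  have down: "hsq lam (Suc i) \<le> C * acoef (Suc (Suc i))" for i
    using order.trans[OF hsq_le_acoef_Suc mult_right_mono[OF C_ge(2) less_imp_le[OF acoef_pos]]] .
  have first: "2 * hsq lam (Suc i) \<le> 4 * C * acoef i" for i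
    using up[of i] hsq_pos[of i] by simp
  have step: "2 * (hsq lam (Suc i) + hsq lam (Suc (Suc (Suc i)))) \<le> 4 * C * acoef (Suc (Suc i))" for i
    using up[of "Suc (Suc i)"] down[of i] by simp
  show "orthogonal_on_Rplus (P_seq lam)"
    unfolding P_seq_def
  proof (rule P.orthogonal_on_Rplus_Prec)
    show "2 / beta_sq lam 1 \<le> 4 * C * alpha_sq lam 1"
      using first[of 1] alpha_sq_Suc[of 0] beta_sq_Suc[of 0] by (simp add: numeral_2_eq_2)
    show "2 * (1 / beta_sq lam (Suc k) + 1 / beta_sq lam (Suc (Suc k))) \<le> 4 * C * alpha_sq lam (Suc (Suc k))" for k
      using step[of "2 * k + 1"] by (simp add: alpha_sq_Suc beta_sq_Suc)
  qed
  show "orthogonal_on_Rplus (P_tilde_seq lam)"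
    unfolding P_tilde_seq_def
  proof (rule T.orthogonal_on_Rplus_Prec)
    show "2 / beta_tilde_sq lam 1 \<le> 4 * C * alpha_tilde_sq lam 1"
      using first[of 0] alpha_tilde_sq_Suc[of 0] beta_tilde_sq_Suc[of 0] by simp
    show "2 * (1 / beta_tilde_sq lam (Suc k) + 1 / beta_tilde_sq lam (Suc (Suc k))) \<le> 4 * C * alpha_tilde_sq lam (Suc (Suc k))" for k
      using step[of "2 * k"] by (simp add: alpha_tilde_sq_Suc beta_tilde_sq_Suc)
  qed
qed

end

theorem theorem2p3:
  fixes lam :: real and m :: nat
  assumes "lam > -1/2" and "m \<ge> 1"
  shows "orthogonal_on_Rplus (P_seq lam) \<and> orthogonal_on_Rplus (P_tilde_seq lam) \<and>
         markov_const (2*m) lam = 2 / sqrt (smallest_zero (P_seq lam m)) \<and>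
         markov_const (2*m - 1) lam = 2 / sqrt (smallest_zero (P_tilde_seq lam m))"
proof -
  interpret gegenbauer lam
    using assms(1) by unfold_locales
  obtain n where n: "m = Suc n"
    using assms(2) by (cases m) auto
  have "markov_const (2 * m) lam = 2 / sqrt (smallest_zero (P_seq lam m))"
    using markov_const_even[of m] assms(2) by (simp add: mu_def)
  moreover have "markov_const (2 * m - 1) lam = 2 / sqrt (smallest_zero (P_tilde_seq lam m))"
    using markov_const_odd[of n] by (simp add: mu_tilde_def n)
  ultimately show ?thesis
    using orthogonal_P orthogonal_P_tilde by blast
qed

end
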